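(* Let $\mathcal C=((V_1,q_1),(V_2,q_2),(V_3,q_3),*_3)$ be a composition of quadratic spaces of dimension $8$ over a field $F$, with derived composition map $*_1\colon V_2\times V_3\to V_1$. For every proper similitude $g_1\in\mathrm{GO}^+(q_1)$, there exist similitudes $g_2\in\mathrm{GO}(q_2)$ and $g_3\in\mathrm{GO}(q_3)$ such that $$g_1(x_2*_1x_3)=g_2(x_2)*_1g_3(x_3)\qquad\text{for all }x_2\in V_2,\ x_3\in V_3.$$
   Context: $F$ is a field of arbitrary characteristic. A composition of quadratic spaces over $F$ is a 4-tuple $((V_1,q_1),(V_2,q_2),(V_3,q_3),*_3)$ where the $(V_i,q_i)$ are finite-dimensional quadratic spaces of the same dimension (the dimension of the composition) with nonsingular polar forms $b_i(x,y)=q_i(x+y)-q_i(x)-q_i(y)$, and $*_3\colon V_1\times V_2\to V_3$ is bilinear with $q_3(x_1*_3x_2)=q_1(x_1)q_2(x_2)$. The derived map $*_1\colon V_2\times V_3\to V_1$ is the bilinear map determined by $b_1(x_1,x_2*_1x_3)=b_3(x_3,x_1*_3x_2)$ for all $x_i\in V_i$. $\mathrm{GO}(q)$ is the group of similitudes of $(V,q)$: linear bijections $g$ of $V$ with $q(g(x))=\mu(g)q(x)$ for all $x$, for some $\mu(g)\in F^\times$. A similitude $g$ induces an automorphism $C_0(g)$ of the even Clifford algebra $C_0(V,q)$ by $C_0(g)(x\cdot y)=\mu(g)^{-1}g(x)\cdot g(y)$; $g$ is proper if $C_0(g)$ is the identity on the center of $C_0(V,q)$, and $\mathrm{GO}^+(q)$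 is the group of proper similitudes. *)

theory Defs
  imports Complex_Main "HOL-Algebra.QuotRing" "HOL-Library.Poly_Mapping" "HOL-Library.FuncSet"
begin

section \<open>Quadratic spaces\<close>

definition polar :: "('v::ab_group_add \<Rightarrow> 'f::field) \<Rightarrow> 'v \<Rightarrow> 'v \<Rightarrow> 'f" where
  "polar q x y = q (x + y) - q x - q y"

definition bilinear_map ::
  "('f::field \<Rightarrow> 'a::ab_group_add \<Rightarrow> 'a) \<Rightarrow> ('f \<Rightarrow> 'b::ab_group_add \<Rightarrow> 'b)
    \<Rightarrow> ('f \<Rightarrow> 'c::ab_group_add \<Rightarrow> 'c) \<Rightarrow> ('a \<Rightarrow> 'b \<Rightarrow> 'c) \<Rightarrow> bool" where
  "bilinear_map s1 s2 s3 f \<longleftrightarrow>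
    (\<forall>x. Vector_Spaces.linear s2 s3 (\<lambda>y. f x y)) \<and>
    (\<forall>y. Vector_Spaces.linear s1 s3 (\<lambda>x. f x y))"

locale quadratic_space = vector_space scale
  for scale :: "'f::field \<Rightarrow> 'v::ab_group_add \<Rightarrow> 'v" +
  fixes q :: "'v \<Rightarrow> 'f"
  assumes finite_dim: "\<exists>B. finite B \<and> span B = UNIV"
    and quad_scale: "q (scale c x) = c\<^sup>2 * q x"
    and polar_bilinear: "bilinear_map scale scale (*) (polar q)"

locale nonsingular_quadratic_space = quadratic_space +
  assumes nonsingular: "(\<And>y. polar q x y = 0) \<Longrightarrow> x = 0"

section \<open>Compositions\<close>

locale quadratic_composition =
  Q1: nonsingular_quadratic_space s1 q1 +
  Q2: nonsingular_quadratic_space s2 q2 +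
  Q3: nonsingular_quadratic_space s3 q3
  for s1 :: "'f::field \<Rightarrow> 'v1::ab_group_add \<Rightarrow> 'v1" and q1 :: "'v1 \<Rightarrow> 'f"
    and s2 :: "'f \<Rightarrow> 'v2::ab_group_add \<Rightarrow> 'v2" and q2 :: "'v2 \<Rightarrow> 'f"
    and s3 :: "'f \<Rightarrow> 'v3::ab_group_add \<Rightarrow> 'v3" and q3 :: "'v3 \<Rightarrow> 'f" +
  fixes star3 :: "'v1 \<Rightarrow> 'v2 \<Rightarrow> 'v3"
  assumes dim_12: "vector_space.dim s1 (UNIV :: 'v1 set) = vector_space.dim s2 (UNIV :: 'v2 set)"
    and dim_13: "vector_space.dim s1 (UNIV :: 'v1 set) = vector_space.dim s3 (UNIV :: 'v3 set)"
    and star3_bilinear: "bilinear_map s1 s2 s3 star3"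
    and star3_mult: "q3 (star3 x1 x2) = q1 x1 * q2 x2"

definition derived_star1 ::
  "('v1::ab_group_add \<Rightarrow> 'f::field) \<Rightarrow> ('v3::ab_group_add \<Rightarrow> 'f) \<Rightarrow> ('v1 \<Rightarrow> 'v2 \<Rightarrow> 'v3)
    \<Rightarrow> 'v2 \<Rightarrow> 'v3 \<Rightarrow> 'v1" where
  "derived_star1 q1 q3 star3 x2 x3 =
    (THE y. \<forall>x1. polar q1 x1 y = polar q3 x3 (star3 x1 x2))"

lemma (in nonsingular_quadratic_space) functional_ex1:
  assumes f: "Vector_Spaces.linear scale (*) f"
  shows "\<exists>!y. \<forall>x. polar q x y = f x"
proof -
  interpret P: vector_space_pair scale "(*) :: 'a \<Rightarrow> 'a \<Rightarrow> 'a"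
    by (intro vector_space_pair.intro vector_space_axioms) (unfold_locales; simp add: algebra_simps)
  have polar_sym: "polar q x y = polar q y x" for x y
    by (simp add: polar_def add.commute)
  have lin1: "Vector_Spaces.linear scale (*) (\<lambda>x. polar q x y)" for y
    using polar_bilinear by (simp add: bilinear_map_def)
  have lin2: "Vector_Spaces.linear scale (*) (\<lambda>y. polar q x y)" for x
    using polar_bilinear by (simp add: bilinear_map_def)
  obtain B0 where B0: "finite B0" "span B0 = UNIV" using finite_dim by blast
  obtain B where B: "B \<subseteq> B0" "independent B" "B0 \<subseteq> span B"
    using maximal_independent_subset[of B0] by blast
  have finB: "finite B" using B B0 finite_subset by blast
  have spanB: "span B = UNIV"
    using B(3) B0(2) by (metis span_mono span_span top.extremum_uniqueI)
  interpret fd: finite_dimensional_vector_space scale B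
    by unfold_locales (use finB B spanB in auto)
  define T where "T y = (\<Sum>e\<in>B. scale (polar q e y) e)" for y
  have Tlin: "Vector_Spaces.linear scale scale T"
  proof -
    have "polar q e (x + y) = polar q e x + polar q e y" for e x y
      using lin2[of e] by (simp add: Vector_Spaces.linear_iff)
    moreover have "polar q e (scale c y) = c * polar q e y" for e c y
      using lin2[of e] by (simp add: Vector_Spaces.linear_iff)
    ultimately show ?thesis
      unfolding T_def Vector_Spaces.linear_iff
      by (simp add: vector_space_axioms scale_left_distrib sum.distrib scale_sum_right)
  qed
  have coeff: "\<forall>e\<in>B. u e = v e" if "(\<Sum>e\<in>B. scale (u e) e) = (\<Sum>e\<in>B. scale (v e) e)" for u v
  proof -
    have "(\<Sum>e\<in>B. scale (u e - v e) e) = 0"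
      using that by (simp add: scale_left_diff_distrib sum_subtractf)
    then show ?thesis using B(2) finB independentD by fastforce
  qed
  have ext: "\<forall>x. h x = k x"
    if "Vector_Spaces.linear scale (*) h" "Vector_Spaces.linear scale (*) k" "\<forall>e\<in>B. h e = k e" for h k
    using P.linear_eq_on_span[OF that(1,2), of B] that(3) spanB by auto
  have uniq: "y = z" if "\<forall>e\<in>B. polar q e y = polar q e z" for y z
  proof -
    have "\<forall>x. polar q x y = polar q x z" using ext[OF lin1 lin1 that] .
    then have "polar q (y - z) x = 0" for x
      using lin2[of x] by (simp add: polar_sym[of _ x] P.linear_diff)
    then show ?thesis using nonsingular[of "y - z"] by simp
  qed
  have "inj T"
    by (rule injI, rule uniq, rule coeff) (simp add: T_def)
  then have "surj T" using fd.linear_inj_imp_surj[OF Tlin] by blast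
  then obtain y where "(\<Sum>e\<in>B. scale (f e) e) = T y" by (rule surjE)
  then have "\<forall>e\<in>B. polar q e y = f e" by (intro coeff) (simp add: T_def)
  then have y: "\<forall>x. polar q x y = f x" by (rule ext[OF lin1 f])
  show ?thesis
  proof (rule ex1I)
    show "\<forall>x. polar q x y = f x" by (rule y)
    show "z = y" if "\<forall>x. polar q x z = f x" for z
      by (rule uniq) (simp add: that y)
  qed
qed

lemma (in quadratic_composition) derived_star1:
  "polar q1 x1 (derived_star1 q1 q3 star3 x2 x3) = polar q3 x3 (star3 x1 x2)"
proof -
  have "Vector_Spaces.linear s1 (*) (\<lambda>x1. polar q3 x3 (star3 x1 x2))"
    using star3_bilinear Q3.polar_bilinear
    unfolding bilinear_map_def Vector_Spaces.linear_iff by auto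
  from theI'[OF Q1.functional_ex1[OF this]] show ?thesis
    unfolding derived_star1_def by blast
qed

lemma (in quadratic_composition) derived_star1_bilinear:
  "bilinear_map s2 s3 s1 (derived_star1 q1 q3 star3)"
proof -
  let ?d = "derived_star1 q1 q3 star3"
  have eqI: "y = z" if "\<And>x. polar q1 x y = polar q1 x z" for y z
    using Q1.functional_ex1[of "\<lambda>x. polar q1 x z"] Q1.polar_bilinear that
    unfolding bilinear_map_def by blast
  have b1: "polar q1 x (y + z) = polar q1 x y + polar q1 x z"
    "polar q1 x (s1 c y) = c * polar q1 x y" for x y z c
    using Q1.polar_bilinear by (simp_all add: bilinear_map_def Vector_Spaces.linear_iff)
  have b3: "polar q3 x (y + z) = polar q3 x y + polar q3 x z"
    "polar q3 x (s3 c y) = c * polar q3 x y"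
    "polar q3 (y + z) x = polar q3 y x + polar q3 z x"
    "polar q3 (s3 c y) x = c * polar q3 y x" for x y z c
    using Q3.polar_bilinear by (simp_all add: bilinear_map_def Vector_Spaces.linear_iff)
  have st: "star3 x (y + z) = star3 x y + star3 x z"
    "star3 x (s2 c y) = s3 c (star3 x y)" for x y z c
    using star3_bilinear by (simp_all add: bilinear_map_def Vector_Spaces.linear_iff)
  show ?thesis
    unfolding bilinear_map_def Vector_Spaces.linear_iff
    by (intro conjI allI Q1.vector_space_axioms Q2.vector_space_axioms Q3.vector_space_axioms eqI)
      (simp_all add: b1 b3 st derived_star1)
qed


section \<open>Similitudes\<close>

definition GO :: "('f::field \<Rightarrow> 'v::ab_group_add \<Rightarrow> 'v) \<Rightarrow> ('v \<Rightarrow> 'f) \<Rightarrow> ('v \<Rightarrow> 'v) set" where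
  "GO scale q = {g. Vector_Spaces.linear scale scale g \<and> bij g \<and>
    (\<exists>\<mu>. \<mu> \<noteq> 0 \<and> (\<forall>x. q (g x) = \<mu> * q x))}"

text \<open>The multiplier is unique as soon as \<^term>\<open>q\<close> is not identically zero.\<close>

definition multiplier :: "('v \<Rightarrow> 'f::field) \<Rightarrow> ('v \<Rightarrow> 'v) \<Rightarrow> 'f" where
  "multiplier q g = (SOME \<mu>. \<mu> \<noteq> 0 \<and> (\<forall>x. q (g x) = \<mu> * q x))"

lemma multiplier:
  assumes "g \<in> GO scale q"
  shows "multiplier q g \<noteq> 0" and "q (g x) = multiplier q g * q x"
proof -
  have "\<exists>\<mu>. \<mu> \<noteq> 0 \<and> (\<forall>x. q (g x) = \<mu> * q x)" using assms by (simp add: GO_def)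
  from someI_ex[OF this]
  show "multiplier q g \<noteq> 0" and "q (g x) = multiplier q g * q x"
    unfolding multiplier_def by blast+
qed

section \<open>The Clifford algebra\<close>

text \<open>Free monoid on a set, written additively so that finitely supported functions
  on it carry the convolution product of the free associative algebra.\<close>

datatype 'v fmonoid = FM (letters: "'v list")

instantiation fmonoid :: (type) monoid_add
begin

definition zero_fmonoid :: "'a fmonoid" where "0 = FM []"

definition plus_fmonoid :: "'a fmonoid \<Rightarrow> 'a fmonoid \<Rightarrow> 'a fmonoid" where
  "v + w = FM (letters v @ letters w)"

instance
  by standard (simp_all add: zero_fmonoid_def plus_fmonoid_def)

end

type_synonym ('v, 'f) free_alg = "'v fmonoid \<Rightarrow>\<^sub>0 'f"

definition free_ring :: "('v, 'f::field) free_alg ring" where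
  "free_ring = \<lparr>carrier = UNIV, mult = (*), one = 1, zero = 0, add = (+)\<rparr>"

definition free_gen :: "'v \<Rightarrow> ('v, 'f::field) free_alg" where
  "free_gen v = Poly_Mapping.single (FM [v]) 1"

definition free_scalar :: "'f::field \<Rightarrow> ('v, 'f) free_alg" where
  "free_scalar c = Poly_Mapping.single 0 c"

text \<open>The first two families of relations turn the free algebra on the set of vectors
  into the tensor algebra; the third one is \<open>v \<otimes> v = q v\<close>.\<close>

definition clifford_relations ::
  "('f::field \<Rightarrow> 'v::ab_group_add \<Rightarrow> 'v) \<Rightarrow> ('v \<Rightarrow> 'f) \<Rightarrow> ('v, 'f) free_alg set" where
  "clifford_relations scale q =
    {free_gen (v + w) - (free_gen v + free_gen w) | v w. True} \<union>
    {free_gen (scale c v) - free_scalar c * free_gen v | c v. True} \<union>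
    {free_gen v * free_gen v - free_scalar (q v) | v. True}"

definition clifford_ideal ::
  "('f::field \<Rightarrow> 'v::ab_group_add \<Rightarrow> 'v) \<Rightarrow> ('v \<Rightarrow> 'f) \<Rightarrow> ('v, 'f) free_alg set" where
  "clifford_ideal scale q = Idl\<^bsub>free_ring\<^esub> (clifford_relations scale q)"

definition clifford ::
  "('f::field \<Rightarrow> 'v::ab_group_add \<Rightarrow> 'v) \<Rightarrow> ('v \<Rightarrow> 'f) \<Rightarrow> ('v, 'f) free_alg set ring" where
  "clifford scale q = free_ring Quot (clifford_ideal scale q)"

definition clifford_proj ::
  "('f::field \<Rightarrow> 'v::ab_group_add \<Rightarrow> 'v) \<Rightarrow> ('v \<Rightarrow> 'f) \<Rightarrow> ('v, 'f) free_alg \<Rightarrow> ('v, 'f) free_alg set" where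
  "clifford_proj scale q x = clifford_ideal scale q +>\<^bsub>free_ring\<^esub> x"

definition clifford_vec where
  "clifford_vec scale q v = clifford_proj scale q (free_gen v)"

definition clifford_scalar where
  "clifford_scalar scale q c = clifford_proj scale q (free_scalar c)"

definition free_even :: "('v, 'f::field) free_alg set" where
  "free_even = {x. \<forall>w\<in>Poly_Mapping.keys x. even (length (letters w))}"

definition even_clifford ::
  "('f::field \<Rightarrow> 'v::ab_group_add \<Rightarrow> 'v) \<Rightarrow> ('v \<Rightarrow> 'f) \<Rightarrow> ('v, 'f) free_alg set ring" where
  "even_clifford scale q = (clifford scale q)\<lparr>carrier := clifford_proj scale q ` free_even\<rparr>"

definition ring_center :: "('a, 'b) ring_scheme \<Rightarrow> 'a set" where
  "ring_center R = {z \<in> carrier R. \<forall>x\<in>carrier R. z \<otimes>\<^bsub>R\<^esub> x = x \<otimes>\<^bsub>R\<^esub> z}"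

section \<open>Proper similitudes\<close>

text \<open>Restriction to extensional functions only fixes the values outside the carrier; the
  third condition is linearity over the field.  Existence and uniqueness of this
  automorphism are proved below.\<close>

definition is_even_clifford_aut where
  "is_even_clifford_aut scale q g \<phi> \<longleftrightarrow>
    \<phi> \<in> ring_iso (even_clifford scale q) (even_clifford scale q) \<and>
    \<phi> \<in> extensional (carrier (even_clifford scale q)) \<and>
    (\<forall>c. \<phi> (clifford_scalar scale q c) = clifford_scalar scale q c) \<and>
    (\<forall>x y. \<phi> (clifford_vec scale q x \<otimes>\<^bsub>clifford scale q\<^esub> clifford_vec scale q y) =
      clifford_scalar scale q (inverse (multiplier q g)) \<otimes>\<^bsub>clifford scale q\<^esub>
        (clifford_vec scale q (g x) \<otimes>\<^bsub>clifford scale q\<^esub> clifford_vec scale q (g y)))"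

definition even_clifford_aut where
  "even_clifford_aut scale q g = (THE \<phi>. is_even_clifford_aut scale q g \<phi>)"

definition GO_plus :: "('f::field \<Rightarrow> 'v::ab_group_add \<Rightarrow> 'v) \<Rightarrow> ('v \<Rightarrow> 'f) \<Rightarrow> ('v \<Rightarrow> 'v) set" where
  "GO_plus scale q = {g \<in> GO scale q.
    \<forall>z\<in>ring_center (even_clifford scale q). even_clifford_aut scale q g z = z}"

subsection \<open>Existence and uniqueness of the automorphism of the even Clifford algebra\<close>

lemma ring_free_ring: "ring (free_ring :: ('v, 'f::field) free_alg ring)"
proof (rule ringI)
  show "abelian_group (free_ring :: ('v, 'f::field) free_alg ring)"
  proof (rule abelian_groupI)
    fix x :: "('v, 'f::field) free_alg"
    show "\<exists>y\<in>carrier free_ring. y \<oplus>\<^bsub>free_ring\<^esub> x = \<zero>\<^bsub>free_ring\<^esub>"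
      by (rule bexI[of _ "- x"]) (simp_all add: free_ring_def)
  qed (simp_all add: free_ring_def add.assoc add.commute)
  show "Group.monoid (free_ring :: ('v, 'f::field) free_alg ring)"
    by (rule Group.monoidI) (simp_all add: free_ring_def mult.assoc)
qed (simp_all add: free_ring_def algebra_simps)

lemma free_ring_simps [simp]:
  "carrier free_ring = UNIV" "mult free_ring = (*)" "one free_ring = 1"
  "zero free_ring = 0" "add free_ring = (+)"
  by (simp_all add: free_ring_def)

lemma free_ring_minus: "x \<ominus>\<^bsub>free_ring\<^esub> y = x - (y :: ('v, 'f::field) free_alg)"
proof -
  interpret ring "free_ring :: ('v, 'f) free_alg ring" by (rule ring_free_ring)
  have "y \<oplus>\<^bsub>free_ring\<^esub> (\<ominus>\<^bsub>free_ring\<^esub> y) = 0" using r_neg[of y] by simp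
  then have "\<ominus>\<^bsub>free_ring\<^esub> y = - y" by (simp add: eq_neg_iff_add_eq_0 add.commute)
  then show ?thesis by (simp add: a_minus_def)
qed

lemma ideal_clifford: "ideal (clifford_ideal scale q) free_ring"
  unfolding clifford_ideal_def by (rule ring.genideal_ideal[OF ring_free_ring]) simp

lemma relations_subset: "clifford_relations scale q \<subseteq> clifford_ideal scale q"
  unfolding clifford_ideal_def by (rule ring.genideal_self[OF ring_free_ring]) simp

lemma clifford_ideal_zero: "0 \<in> clifford_ideal scale q"
  using additive_subgroup.zero_closed[OF ideal.axioms(1)[OF ideal_clifford[of scale q]]] by simp

lemma clifford_ideal_add:
  "x \<in> clifford_ideal scale q \<Longrightarrow> y \<in> clifford_ideal scale q \<Longrightarrow> x + y \<in> clifford_ideal scale q"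
  using additive_subgroup.a_closed[OF ideal.axioms(1)[OF ideal_clifford[of scale q]]] by simp

lemma clifford_ideal_lmult: "x \<in> clifford_ideal scale q \<Longrightarrow> a * x \<in> clifford_ideal scale q"
  using ideal.I_l_closed[OF ideal_clifford[of scale q], of x a] by simp

lemma clifford_ideal_rmult: "x \<in> clifford_ideal scale q \<Longrightarrow> x * a \<in> clifford_ideal scale q"
  using ideal.I_r_closed[OF ideal_clifford[of scale q], of x a] by simp

lemma clifford_proj_eq_iff:
  "clifford_proj scale q x = clifford_proj scale q y \<longleftrightarrow> x - y \<in> clifford_ideal scale q"
  using ring.quotient_eq_iff_same_a_r_cos[OF ring_free_ring ideal_clifford[of scale q], of x y]
  by (simp add: clifford_proj_def free_ring_minus)

lemma clifford_proj_hom: "clifford_proj scale q \<in> ring_hom free_ring (clifford scale q)"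
  using ideal.rcos_ring_hom[OF ideal_clifford[of scale q]]
  by (simp add: clifford_proj_def[abs_def] clifford_def)

lemma clifford_proj_simps:
  "clifford_proj scale q (x * y) =
    clifford_proj scale q x \<otimes>\<^bsub>clifford scale q\<^esub> clifford_proj scale q y"
  "clifford_proj scale q (x + y) =
    clifford_proj scale q x \<oplus>\<^bsub>clifford scale q\<^esub> clifford_proj scale q y"
  "clifford_proj scale q 1 = \<one>\<^bsub>clifford scale q\<^esub>"
  using ring_hom_mult[OF clifford_proj_hom[of scale q], of x y]
    ring_hom_add[OF clifford_proj_hom[of scale q], of x y]
    ring_hom_one[OF clifford_proj_hom[of scale q]] by simp_all

lemma free_alg_induct [case_names zero single add]:
  fixes x :: "'a \<Rightarrow>\<^sub>0 'f::field"
  assumes "P 0" "\<And>w c. P (Poly_Mapping.single w c)" "\<And>x y. P x \<Longrightarrow> P y \<Longrightarrow> P (x + y)"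
  shows "P x"
proof -
  have "x = (\<Sum>w\<in>Poly_Mapping.keys x. Poly_Mapping.single w (Poly_Mapping.lookup x w))"
    by (rule poly_mapping_eqI)
      (simp add: lookup_sum lookup_single when_def in_keys_iff)
  moreover have "P (\<Sum>w\<in>A. Poly_Mapping.single w (Poly_Mapping.lookup x w))" if "finite A" for A
    using that by induction (auto intro: assms)
  ultimately show ?thesis by (metis finite_keys)
qed

definition linear_ext :: "('a \<Rightarrow> 'f \<Rightarrow> ('b \<Rightarrow>\<^sub>0 'f)) \<Rightarrow> ('a \<Rightarrow>\<^sub>0 'f) \<Rightarrow> ('b \<Rightarrow>\<^sub>0 'f::field)" where
  "linear_ext f x = (\<Sum>w\<in>Poly_Mapping.keys x. f w (Poly_Mapping.lookup x w))"

context
  fixes f :: "'a \<Rightarrow> 'f \<Rightarrow> ('b \<Rightarrow>\<^sub>0 'f::field)"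
  assumes fz: "\<And>w. f w 0 = 0" and fadd: "\<And>w c d. f w (c + d) = f w c + f w d"
begin

lemma linear_ext_superset:
  "finite A \<Longrightarrow> Poly_Mapping.keys x \<subseteq> A \<Longrightarrow> linear_ext f x = (\<Sum>w\<in>A. f w (Poly_Mapping.lookup x w))"
  unfolding linear_ext_def by (rule sum.mono_neutral_left) (auto simp: in_keys_iff fz)

lemma linear_ext_add: "linear_ext f (x + y) = linear_ext f x + linear_ext f y"
proof -
  let ?A = "Poly_Mapping.keys x \<union> Poly_Mapping.keys y"
  have "linear_ext f z = (\<Sum>w\<in>?A. f w (Poly_Mapping.lookup z w))" if "z \<in> {x, y, x + y}" for z
    using that Poly_Mapping.keys_add[of x y] by (intro linear_ext_superset) auto
  then show ?thesis by (simp add: lookup_add fadd sum.distrib)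
qed

lemma linear_ext_zero: "linear_ext f 0 = 0"
  by (simp add: linear_ext_def)

lemma linear_ext_single: "linear_ext f (Poly_Mapping.single w c) = f w c"
  by (simp add: linear_ext_def fz)

end

definition even_part :: "('v, 'f::field) free_alg \<Rightarrow> ('v, 'f) free_alg" where
  "even_part = linear_ext (\<lambda>w c. if even (length (letters w)) then Poly_Mapping.single w c else 0)"

definition odd_part :: "('v, 'f::field) free_alg \<Rightarrow> ('v, 'f) free_alg" where
  "odd_part = linear_ext (\<lambda>w c. if even (length (letters w)) then 0 else Poly_Mapping.single w c)"

text \<open>On even words this lifts the automorphism to the free algebra.  It is not multiplicative
  on products of odd elements, hence the separate treatment of parities.\<close>

definition twist :: "'f \<Rightarrow> ('v \<Rightarrow> 'v) \<Rightarrow> ('v, 'f::field) free_alg \<Rightarrow> ('v, 'f) free_alg" where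
  "twist m g = linear_ext (\<lambda>w c. Poly_Mapping.single (FM (map g (letters w)))
    (c * inverse m ^ (length (letters w) div 2)))"

lemma even_part_simps:
  "even_part 0 = 0" "even_part (x + y) = even_part x + even_part y"
  "even_part (Poly_Mapping.single w c) = (if even (length (letters w)) then Poly_Mapping.single w c else 0)"
  unfolding even_part_def by (subst linear_ext_zero linear_ext_add linear_ext_single; simp add: single_add)+

lemma odd_part_simps:
  "odd_part 0 = 0" "odd_part (x + y) = odd_part x + odd_part y"
  "odd_part (Poly_Mapping.single w c) = (if even (length (letters w)) then 0 else Poly_Mapping.single w c)"
  unfolding odd_part_def by (subst linear_ext_zero linear_ext_add linear_ext_single; simp add: single_add)+

lemma twist_simps:
  "twist m g 0 = 0" "twist m g (x + y) = twist m g x + twist m g y"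
  "twist m g (Poly_Mapping.single w c) = Poly_Mapping.single (FM (map g (letters w)))
    (c * inverse m ^ (length (letters w) div 2))"
  unfolding twist_def by (subst linear_ext_zero linear_ext_add linear_ext_single; simp add: single_add algebra_simps)+

lemma additive_minus:
  fixes h :: "'a::ab_group_add \<Rightarrow> 'b::ab_group_add"
  assumes "\<And>x y. h (x + y) = h x + h y"
  shows "h (x - y) = h x - h y"
  using assms[of "x - y" y] by simp

lemmas even_part_minus = additive_minus[of even_part, OF even_part_simps(2)]
lemmas odd_part_minus = additive_minus[of odd_part, OF odd_part_simps(2)]
lemmas twist_minus = additive_minus[of "twist m g" for m g, OF twist_simps(2)]

lemma even_part_free_even: "x \<in> free_even \<Longrightarrow> even_part x = x"
proof -
  assume "x \<in> free_even"
  then have "even_part x = linear_ext (\<lambda>w c. Poly_Mapping.single w c) x"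
    unfolding even_part_def linear_ext_def free_even_def by (intro sum.cong) auto
  also have "\<dots> = x"
    by (induction x rule: free_alg_induct)
      (subst linear_ext_zero linear_ext_add linear_ext_single; simp add: single_add)+
  finally show ?thesis .
qed

lemma even_part_in_free_even: "even_part x \<in> free_even"
proof (induction x rule: free_alg_induct)
  case (add x y)
  then show ?case
    using Poly_Mapping.keys_add[of "even_part x" "even_part y"] by (auto simp: even_part_simps free_even_def)
qed (auto simp: even_part_simps free_even_def)

lemma letters_simps [simp]: "letters 0 = []" "letters (v + w) = letters v @ letters w"
  by (simp_all add: zero_fmonoid_def plus_fmonoid_def)

lemma parts_mult:
  "even_part (x * y) = even_part x * even_part y + odd_part x * odd_part y"
  "odd_part (x * y) = even_part x * odd_part y + odd_part x * even_part y"
proof -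
  have *: "even_part (x * y) = even_part x * even_part y + odd_part x * odd_part y \<and> odd_part (x * y) = even_part x * odd_part y + odd_part x * even_part y"
  proof (induction x rule: free_alg_induct)
    case (single v c)
    show ?case
      by (induction y rule: free_alg_induct)
        (simp_all add: even_part_simps odd_part_simps mult_single algebra_simps)
  qed (simp_all add: even_part_simps odd_part_simps algebra_simps)
  then show "even_part (x * y) = even_part x * even_part y + odd_part x * odd_part y"
    "odd_part (x * y) = even_part x * odd_part y + odd_part x * even_part y" by blast+
qed

lemma twist_mult_aux:
  "twist m g (even_part x * y) = twist m g (even_part x) * twist m g y \<and>
   twist m g (odd_part x * even_part y) = twist m g (odd_part x) * twist m g (even_part y) \<and>
   twist m g (odd_part x * odd_part y) = free_scalar (inverse m) * (twist m g (odd_part x) * twist m g (odd_part y))"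
proof (induction x rule: free_alg_induct)
  case (single v c)
  show ?case
  proof (induction y rule: free_alg_induct)
    case (single w d)
    have 1: "FM (map g (letters v) @ map g (letters w)) = FM (map g (letters v)) + FM (map g (letters w))"
      by (simp add: plus_fmonoid_def)
    have "even (length (letters v)) \<or> even (length (letters w)) \<Longrightarrow>
      (length (letters v) + length (letters w)) div 2 = length (letters v) div 2 + length (letters w) div 2"
      by (auto elim!: evenE)
    moreover have "odd (length (letters v)) \<Longrightarrow> odd (length (letters w)) \<Longrightarrow>
      (length (letters v) + length (letters w)) div 2 =
        Suc (length (letters v) div 2 + length (letters w) div 2)"
      by (auto elim!: oddE)
    ultimately show ?case
      by (auto simp: even_part_simps odd_part_simps twist_simps mult_single free_scalar_def 1 power_add mult_ac)
  qed (simp_all add: even_part_simps odd_part_simps twist_simps algebra_simps)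
qed (simp_all add: even_part_simps odd_part_simps twist_simps algebra_simps)

lemmas twist_mult = twist_mult_aux[THEN conjunct1] twist_mult_aux[THEN conjunct2, THEN conjunct1]
  twist_mult_aux[THEN conjunct2, THEN conjunct2]

lemma twist_in_free_even: "x \<in> free_even \<Longrightarrow> twist m g x \<in> free_even"
proof -
  have "twist m g (even_part x) \<in> free_even"
  proof (induction x rule: free_alg_induct)
    case (add x y)
    then show ?case
      using Poly_Mapping.keys_add[of "twist m g (even_part x)" "twist m g (even_part y)"]
      by (auto simp: even_part_simps twist_simps free_even_def)
  qed (auto simp: even_part_simps twist_simps free_even_def)
  then show "x \<in> free_even \<Longrightarrow> twist m g x \<in> free_even" by (simp add: even_part_free_even)
qed

lemma free_evenI: "even_part x = x \<Longrightarrow> x \<in> free_even"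
  using even_part_in_free_even[of x] by simp

lemma odd_part_free_even: "x \<in> free_even \<Longrightarrow> odd_part x = 0"
proof -
  have "odd_part (even_part x) = 0" by (induction x rule: free_alg_induct) (simp_all add: odd_part_simps even_part_simps)
  then show "x \<in> free_even \<Longrightarrow> odd_part x = 0" by (simp add: even_part_free_even)
qed

lemma free_scalar_even: "free_scalar c \<in> free_even"
  by (rule free_evenI) (simp add: free_scalar_def even_part_simps)

lemma free_one_even: "1 \<in> free_even"
  using free_scalar_even[of 1] by (simp add: free_scalar_def)

lemma free_gen_mult_even: "free_gen v * free_gen w \<in> free_even"
  by (rule free_evenI) (simp add: free_gen_def mult_single even_part_simps)

lemma free_even_closed:
  assumes "x \<in> free_even" "y \<in> free_even"
  shows "x + y \<in> free_even" "x - y \<in> free_even" "x * y \<in> free_even"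
  using assms
  by (auto intro!: free_evenI simp: even_part_simps even_part_minus parts_mult even_part_free_even odd_part_free_even)

lemma twist_clifford_ideal:
  fixes scale :: "'f::field \<Rightarrow> 'v::ab_group_add \<Rightarrow> 'v"
  assumes lin: "Vector_Spaces.linear scale scale g"
    and m: "m \<noteq> 0" "\<And>x. q (g x) = m * q x"
    and x: "x \<in> clifford_ideal scale q" "x \<in> free_even"
  shows "twist m g x \<in> clifford_ideal scale q"
proof -
  let ?I = "clifford_ideal scale q"
  let ?J = "{x. twist m g (even_part x) \<in> ?I \<and> twist m g (odd_part x) \<in> ?I}"
  note I = clifford_ideal_zero clifford_ideal_add clifford_ideal_lmult clifford_ideal_rmult
  have g_add: "g (v + w) = g v + g w" and g_scale: "g (scale c v) = scale c (g v)" for v w c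
    using lin by (simp_all add: Vector_Spaces.linear_iff)
  have gen: "even_part (free_gen v) = 0" "odd_part (free_gen v) = free_gen v" "twist m g (free_gen v) = free_gen (g v)"
    for v by (simp_all add: free_gen_def even_part_simps odd_part_simps twist_simps)
  have sc: "even_part (free_scalar c) = free_scalar c" "odd_part (free_scalar c) = 0"
    "twist m g (free_scalar c) = free_scalar c" for c
    by (simp_all add: free_scalar_def even_part_simps odd_part_simps twist_simps zero_fmonoid_def)
  have sc_mult: "free_scalar (a * b) = free_scalar a * free_scalar b" for a b :: 'f
    by (simp add: free_scalar_def mult_single)
  have "ideal ?J free_ring"
  proof (rule idealI[OF ring_free_ring])
    have neg: "- y \<in> ?I" if "y \<in> ?I" for y
      using I(3)[OF that, of "- 1"] by simp
    have tneg: "h (- y) = - h y"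
      if "\<And>x y. h (x + y) = h x + h y" for h :: "('v,'f) free_alg \<Rightarrow> ('v,'f) free_alg" and y
      using additive_minus[of h 0 y, OF that] that[of 0 0] by simp
    have inv: "inv\<^bsub>add_monoid free_ring\<^esub> y = - y" for y :: "('v, 'f) free_alg"
      using free_ring_minus[of 0 y] by (simp add: a_minus_def a_inv_def)
    note tnegs = tneg[of even_part, OF even_part_simps(2)] tneg[of odd_part, OF odd_part_simps(2)]
      tneg[of "twist m g", OF twist_simps(2)]
    show "subgroup ?J (add_monoid free_ring)"
    proof (rule group.subgroupI[OF abelian_group.a_group[OF ring.is_abelian_group[OF ring_free_ring]]])
      have "0 \<in> ?J" by (simp add: even_part_simps odd_part_simps twist_simps I(1))
      then show "?J \<noteq> {}" by blast
      show "inv\<^bsub>add_monoid free_ring\<^esub> y \<in> ?J" if "y \<in> ?J" for y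
        unfolding inv using that by (simp add: tnegs neg)
      show "y \<otimes>\<^bsub>add_monoid free_ring\<^esub> z \<in> ?J" if "y \<in> ?J" "z \<in> ?J" for y z
        using that by (simp add: even_part_simps odd_part_simps twist_simps I(2))
    qed simp
  next
    fix x a :: "('v, 'f) free_alg"
    assume x: "x \<in> ?J"
    then have x: "twist m g (even_part x) \<in> ?I" "twist m g (odd_part x) \<in> ?I" by simp_all
    show "a \<otimes>\<^bsub>free_ring\<^esub> x \<in> ?J"
      by (simp add: parts_mult twist_simps twist_mult) (intro conjI I(2,3) x)
    show "x \<otimes>\<^bsub>free_ring\<^esub> a \<in> ?J"
      by (simp add: parts_mult twist_simps twist_mult) (intro conjI I(2) I(4) I(3)[OF I(4)] x)
  qed
  moreover have "clifford_relations scale q \<subseteq> ?J"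
  proof -
    have rel: "r \<in> ?I" if "r \<in> clifford_relations scale q" for r
      using that relations_subset by blast
    have 1: "free_gen (v + w) - (free_gen v + free_gen w) \<in> ?J" for v w
    proof -
      have "free_gen (g v + g w) - (free_gen (g v) + free_gen (g w)) \<in> ?I"
        by (rule rel) (auto simp: clifford_relations_def)
      then show ?thesis
        by (simp add: even_part_minus odd_part_minus twist_minus even_part_simps odd_part_simps twist_simps gen g_add I)
    qed
    have 2: "free_gen (scale c v) - free_scalar c * free_gen v \<in> ?J" for c v
    proof -
      have "twist m g (free_scalar c * free_gen v) = free_scalar c * free_gen (g v)"
        using twist_mult(1)[of m g "free_scalar c" "free_gen v"] by (simp add: gen sc)
      moreover have "free_gen (scale c (g v)) - free_scalar c * free_gen (g v) \<in> ?I"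
        by (rule rel) (auto simp: clifford_relations_def)
      ultimately show ?thesis
        by (simp add: even_part_minus odd_part_minus twist_minus twist_simps parts_mult gen sc g_scale I)
    qed
    have 3: "free_gen v * free_gen v - free_scalar (q v) \<in> ?J" for v
    proof -
      have "q v = inverse m * q (g v)" using m by simp
      then have "free_scalar (q v) = free_scalar (inverse m) * free_scalar (q (g v))"
        by (simp only: sc_mult)
      then have "twist m g (free_gen v * free_gen v - free_scalar (q v)) =
          free_scalar (inverse m) * (free_gen (g v) * free_gen (g v) - free_scalar (q (g v)))"
        using twist_mult(3)[of m g "free_gen v" "free_gen v"] sc(3)[of "q v"]
        by (simp add: gen twist_minus right_diff_distrib)
      moreover have "free_gen (g v) * free_gen (g v) - free_scalar (q (g v)) \<in> ?I"
        by (rule rel) (auto simp: clifford_relations_def)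
      ultimately show ?thesis
        by (simp add: even_part_minus odd_part_minus parts_mult gen sc twist_simps I)
    qed
    show ?thesis
      unfolding clifford_relations_def using 1 2 3 by blast
  qed
  ultimately have "?I \<subseteq> ?J"
    unfolding clifford_ideal_def by (rule ring.genideal_minimal[OF ring_free_ring])
  from subsetD[OF this x(1)] show ?thesis by (simp add: even_part_free_even[OF x(2)])
qed


lemma even_clifford_simps [simp]:
  "carrier (even_clifford scale q) = clifford_proj scale q ` free_even"
  "mult (even_clifford scale q) = mult (clifford scale q)"
  "add (even_clifford scale q) = add (clifford scale q)"
  "one (even_clifford scale q) = one (clifford scale q)"
  "zero (even_clifford scale q) = zero (clifford scale q)"
  by (simp_all add: even_clifford_def)

lemma GO_inv:
  fixes scale :: "'f::field \<Rightarrow> 'v::ab_group_add \<Rightarrow> 'v"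
  assumes "g \<in> GO scale q"
  shows "Vector_Spaces.linear scale scale (inv_into UNIV g)"
    and "q (inv_into UNIV g x) = inverse (multiplier q g) * q x"
proof -
  have lin: "Vector_Spaces.linear scale scale g" and bij: "bij g"
    using assms by (simp_all add: GO_def)
  have g: "g (inv_into UNIV g x) = x" for x using bij by (simp add: bij_is_surj surj_f_inv_f)
  have inj: "x = y" if "g x = g y" for x y
    using that bij by (meson bij_is_inj injD)
  show "Vector_Spaces.linear scale scale (inv_into UNIV g)"
    unfolding Vector_Spaces.linear_iff
  proof (intro conjI allI)
    show "vector_space scale" using lin by (simp add: Vector_Spaces.linear_iff)
    then show "vector_space scale" .
    show "inv_into UNIV g (x + y) = inv_into UNIV g x + inv_into UNIV g y" for x y
      by (rule inj) (use lin in \<open>simp add: Vector_Spaces.linear_iff g\<close>)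
    show "inv_into UNIV g (scale c x) = scale c (inv_into UNIV g x)" for c x
      by (rule inj) (use lin in \<open>simp add: Vector_Spaces.linear_iff g\<close>)
  qed
  have "q x = multiplier q g * q (inv_into UNIV g x)"
    using multiplier(2)[OF assms, of "inv_into UNIV g x"] by (simp add: g)
  then show "q (inv_into UNIV g x) = inverse (multiplier q g) * q x"
    using multiplier(1)[OF assms] by simp
qed

lemma twist_twist:
  assumes "m * n = 1" "\<And>v. h (g v) = v"
  shows "twist n h (twist m g x) = x"
proof (induction x rule: free_alg_induct)
  case (single w c)
  have "inverse m ^ k * inverse n ^ k = 1" for k
  proof -
    have "inverse m * inverse n = 1" using assms(1) by (simp flip: inverse_mult_distrib)
    then show ?thesis by (simp flip: power_mult_distrib)
  qed
  then show ?case
    by (simp add: twist_simps o_def assms(2) mult.assoc)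
qed (simp_all add: twist_simps)

lemma even_clifford_aut_ex:
  fixes scale :: "'f::field \<Rightarrow> 'v::ab_group_add \<Rightarrow> 'v"
  assumes g: "g \<in> GO scale q"
  shows "\<exists>\<phi>. is_even_clifford_aut scale q g \<phi>"
proof -
  let ?p = "clifford_proj scale q" and ?C = "clifford scale q" and ?E = "even_clifford scale q"
  define m where "m = multiplier q g"
  define h where "h = inv_into UNIV g"
  have bij: "bij g" and lin: "Vector_Spaces.linear scale scale g" using g by (simp_all add: GO_def)
  have gh: "g (h v) = v" and hg: "h (g v) = v" for v
    using bij by (simp_all add: h_def bij_is_surj surj_f_inv_f bij_is_inj)
  have m: "m \<noteq> 0" "q (g x) = m * q x" for x
    using multiplier[OF g] by (simp_all add: m_def)
  have hlin: "Vector_Spaces.linear scale scale h" and hm: "q (h x) = inverse m * q x" for x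
    using GO_inv[OF g] by (simp_all add: h_def m_def)
  have wd: "?p (twist m g x) = ?p (twist m g y)"
    if "x \<in> free_even" "y \<in> free_even" "?p x = ?p y" for x y
    using twist_clifford_ideal[of scale g m q "x - y", OF lin m] that
    by (simp add: clifford_proj_eq_iff free_even_closed twist_minus)
  have wd': "?p x = ?p y"
    if "x \<in> free_even" "y \<in> free_even" "?p (twist m g x) = ?p (twist m g y)" for x y
  proof -
    have "twist (inverse m) h (twist m g x - twist m g y) \<in> clifford_ideal scale q"
      using that m by (intro twist_clifford_ideal[of scale h "inverse m" q, OF hlin _ hm])
        (simp_all add: clifford_proj_eq_iff free_even_closed twist_in_free_even)
    then show ?thesis
      using twist_twist[of m "inverse m" h g] m hg by (simp add: clifford_proj_eq_iff twist_minus)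
  qed
  define \<phi> where "\<phi> = restrict (\<lambda>X. ?p (twist m g (SOME x. x \<in> free_even \<and> ?p x = X))) (carrier ?E)"
  have \<phi>: "\<phi> (?p x) = ?p (twist m g x)" if "x \<in> free_even" for x
  proof -
    let ?y = "SOME y. y \<in> free_even \<and> ?p y = ?p x"
    have "\<exists>y. y \<in> free_even \<and> ?p y = ?p x" using that by blast
    from someI_ex[OF this] have "?y \<in> free_even" "?p ?y = ?p x" by simp_all
    then have "?p (twist m g ?y) = ?p (twist m g x)" by (intro wd that)
    then show ?thesis using that by (simp add: \<phi>_def)
  qed
  have sc: "twist m g (free_scalar c) = free_scalar c" for c
    by (simp add: free_scalar_def twist_simps zero_fmonoid_def)
  have "\<phi> \<in> ring_hom ?E ?E"
  proof (rule ring_hom_memI)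
    fix X Y assume "X \<in> carrier ?E" "Y \<in> carrier ?E"
    then obtain x y where xy: "x \<in> free_even" "y \<in> free_even" "X = ?p x" "Y = ?p y" by auto
    show "\<phi> X \<in> carrier ?E" using xy by (simp add: \<phi> twist_in_free_even)
    have "twist m g (x * y) = twist m g x * twist m g y"
      using twist_mult(1)[of m g x y] xy by (simp add: even_part_free_even)
    then show "\<phi> (X \<otimes>\<^bsub>?E\<^esub> Y) = \<phi> X \<otimes>\<^bsub>?E\<^esub> \<phi> Y"
      using xy by (simp add: \<phi> free_even_closed flip: clifford_proj_simps)
    show "\<phi> (X \<oplus>\<^bsub>?E\<^esub> Y) = \<phi> X \<oplus>\<^bsub>?E\<^esub> \<phi> Y"
      using xy by (simp add: \<phi> free_even_closed twist_simps flip: clifford_proj_simps)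
  next
    show "\<phi> \<one>\<^bsub>?E\<^esub> = \<one>\<^bsub>?E\<^esub>"
      using sc[of 1] by (simp add: \<phi> free_one_even free_scalar_def flip: clifford_proj_simps)
  qed
  moreover have "bij_betw \<phi> (carrier ?E) (carrier ?E)"
  proof (rule bij_betw_imageI)
    show "inj_on \<phi> (carrier ?E)"
    proof (rule inj_onI)
      fix X Y assume "X \<in> carrier ?E" "Y \<in> carrier ?E" and eq: "\<phi> X = \<phi> Y"
      then obtain x y where xy: "x \<in> free_even" "y \<in> free_even" "X = ?p x" "Y = ?p y" by auto
      then have "?p (twist m g x) = ?p (twist m g y)" using eq by (simp add: \<phi>)
      then show "X = Y" using wd'[OF xy(1,2)] xy by simp
    qed
    have "?p x \<in> \<phi> ` carrier ?E" if "x \<in> free_even" for x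
    proof -
      have "twist m g (twist (inverse m) h x) = x" using twist_twist[of "inverse m" m g h] m gh by simp
      then have "\<phi> (?p (twist (inverse m) h x)) = ?p x" using that by (simp add: \<phi> twist_in_free_even)
      then show ?thesis using that by (metis even_clifford_simps(1) imageI twist_in_free_even)
    qed
    then show "\<phi> ` carrier ?E = carrier ?E"
      by (auto simp: \<phi> twist_in_free_even)
  qed
  moreover have "\<phi> \<in> extensional (carrier ?E)" by (simp add: \<phi>_def)
  moreover have "\<phi> (clifford_scalar scale q c) = clifford_scalar scale q c" for c
    by (simp add: clifford_scalar_def \<phi> free_scalar_even sc)
  moreover have "\<phi> (clifford_vec scale q x \<otimes>\<^bsub>?C\<^esub> clifford_vec scale q y) =
      clifford_scalar scale q (inverse (multiplier q g)) \<otimes>\<^bsub>?C\<^esub>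
        (clifford_vec scale q (g x) \<otimes>\<^bsub>?C\<^esub> clifford_vec scale q (g y))" for x y
  proof -
    have "twist m g (free_gen x * free_gen y) = free_scalar (inverse m) * (free_gen (g x) * free_gen (g y))"
      using twist_mult(3)[of m g "free_gen x" "free_gen y"]
      by (simp add: free_gen_def odd_part_simps twist_simps)
    then show ?thesis
      by (simp add: clifford_scalar_def clifford_vec_def m_def \<phi> free_gen_mult_even
          flip: clifford_proj_simps)
  qed
  ultimately show ?thesis
    unfolding is_even_clifford_aut_def ring_iso_def by blast
qed

lemma free_even_induct [consumes 1, case_names scalar gens add mult]:
  assumes "x \<in> free_even"
    and "\<And>c. P (free_scalar c)" "\<And>v w. P (free_gen v * free_gen w)"
    and add: "\<And>x y. x \<in> free_even \<Longrightarrow> y \<in> free_even \<Longrightarrow> P x \<Longrightarrow> P y \<Longrightarrow> P (x + y)"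
    and mult: "\<And>x y. x \<in> free_even \<Longrightarrow> y \<in> free_even \<Longrightarrow> P x \<Longrightarrow> P y \<Longrightarrow> P (x * y)"
  shows "P x"
proof -
  have zero: "P 0" using assms(2)[of 0] by (simp add: free_scalar_def)
  have word: "P (Poly_Mapping.single (FM l) c)" if "even (length l)" for l c
    using that
  proof (induction l arbitrary: c rule: induct_list012)
    case 1
    show ?case using assms(2)[of c] by (simp add: free_scalar_def zero_fmonoid_def)
  next
    case (3 v w l)
    have "Poly_Mapping.single (FM (v # w # l)) c =
        (free_gen v * free_gen w) * Poly_Mapping.single (FM l) c"
      by (simp add: free_gen_def mult_single plus_fmonoid_def)
    moreover have "Poly_Mapping.single (FM l) c \<in> free_even"
      using 3 by (intro free_evenI) (simp add: even_part_simps)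
    ultimately show ?case
      using 3 by (auto intro!: mult assms(3) free_gen_mult_even)
  qed simp
  have "P (even_part x)"
  proof (induction x rule: free_alg_induct)
    case (single w c)
    show ?case using word[of "letters w" c] zero by (simp add: even_part_simps)
  qed (auto simp: even_part_simps zero intro: add even_part_in_free_even)
  then show ?thesis using assms(1) by (simp add: even_part_free_even)
qed

lemma even_clifford_aut_unique:
  assumes "is_even_clifford_aut scale q g \<phi>" "is_even_clifford_aut scale q g \<psi>"
  shows "\<phi> = \<psi>"
proof -
  let ?p = "clifford_proj scale q" and ?E = "even_clifford scale q"
  have hom: "\<phi> \<in> ring_hom ?E ?E" "\<psi> \<in> ring_hom ?E ?E"
    and ext: "\<phi> \<in> extensional (carrier ?E)" "\<psi> \<in> extensional (carrier ?E)"
    using assms by (auto simp: is_even_clifford_aut_def ring_iso_def)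
  have "\<phi> (?p x) = \<psi> (?p x)" if "x \<in> free_even" for x
    using that
  proof (induction x rule: free_even_induct)
    case (scalar c)
    then show ?case using assms by (simp add: is_even_clifford_aut_def flip: clifford_scalar_def)
  next
    case (gens v w)
    then show ?case using assms
      by (simp add: is_even_clifford_aut_def clifford_proj_simps flip: clifford_vec_def)
  next
    case (add x y)
    then show ?case
      using ring_hom_add[OF hom(1), of "?p x" "?p y"] ring_hom_add[OF hom(2), of "?p x" "?p y"]
      by (simp add: clifford_proj_simps)
  next
    case (mult x y)
    then show ?case
      using ring_hom_mult[OF hom(1), of "?p x" "?p y"] ring_hom_mult[OF hom(2), of "?p x" "?p y"]
      by (simp add: clifford_proj_simps)
  qed
  then show ?thesis
    by (intro extensionalityI[OF ext]) auto
qed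

lemma even_clifford_aut:
  assumes "g \<in> GO scale q"
  shows "is_even_clifford_aut scale q g (even_clifford_aut scale q g)"
  unfolding even_clifford_aut_def
  using theI'[OF ex_ex1I[OF even_clifford_aut_ex[OF assms] even_clifford_aut_unique]] .

end

theory Submission
  imports Defs "HOL-Library.Product_Plus" "HOL-Library.Function_Algebras"
begin

text \<open>With \<open>adj x\<close> the adjoint of \<open>star3 x\<close>, the operators \<open>(y, z) \<mapsto> (adj x z, star3 x y)\<close> on
  \<open>V2 \<times> V3\<close> square to \<open>q1 x\<close>.  Their ordered monomials in a basis of \<open>V1\<close> are
  \<open>2\<^sup>8 = 16\<^sup>2\<close> independent operators, so the Clifford algebra of \<open>q1\<close> acts faithfully and by all
  endomorphisms.  Precomposing with \<open>g1\<close>, and rescaling by the multiplier on one summand, gives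
  a second such module; as in the Skolem-Noether theorem, the two are related by a bijective
  intertwiner, built from the elements that act with rank one.  The projection onto \<open>V2\<close> is
  the action of a central element of the even Clifford algebra, which \<open>g1\<close> fixes since it is proper, so
  the intertwiner splits as \<open>(h2, h3)\<close> with \<open>h3 (star3 x y) = star3 (g1 x) (h2 y)\<close>.  Writing every
  vector of \<open>V3\<close> as \<open>star3 x y\<close> with a fixed anisotropic \<open>y\<close> shows that \<open>h2\<close> and \<open>h3\<close> are
  similitudes, and a scalar multiple of \<open>h3\<close> gives \<open>g3\<close>.\<close>

section \<open>Evaluating the free algebra on a module\<close>

text \<open>The leftmost letter acts last, so concatenating words composes operators. Evaluating
  before passing to the quotient avoids any choice of representatives.\<close>

definition clifford_eval ::
  "('f::field \<Rightarrow> 'w::ab_group_add \<Rightarrow> 'w) \<Rightarrow> ('v \<Rightarrow> 'w \<Rightarrow> 'w) \<Rightarrow> ('v, 'f) free_alg \<Rightarrow> 'w \<Rightarrow> 'w" where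
  "clifford_eval t a x w =
    (\<Sum>m\<in>Poly_Mapping.keys x. t (Poly_Mapping.lookup x m) (foldr a (letters m) w))"

lemma free_scalar_commute: "free_scalar c * x = x * (free_scalar c :: ('v, 'f::field) free_alg)"
proof (induction x rule: free_alg_induct)
  case (single w d)
  then show ?case by (simp add: free_scalar_def mult_single mult.commute)
qed (simp_all add: algebra_simps)

lemma free_scalar_simps:
  "free_scalar (a + b) = free_scalar a + free_scalar b"
  "free_scalar (a * b) = free_scalar a * free_scalar b"
  "free_scalar 0 = 0" "free_scalar 1 = 1"
  for a b :: "'f::field"
  by (simp_all add: free_scalar_def mult_single single_add)

text \<open>The operator \<open>p\<close> is the projection onto one of the two summands
  of a \<open>\<int>/2\<close>-graded module; a sign operator would carry no information in characteristic two.\<close>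

locale clifford_module = V: nonsingular_quadratic_space s q + W: vector_space t
  for s :: "'f::field \<Rightarrow> 'v::ab_group_add \<Rightarrow> 'v" and q :: "'v \<Rightarrow> 'f"
    and t :: "'f \<Rightarrow> 'w::ab_group_add \<Rightarrow> 'w" +
  fixes act :: "'v \<Rightarrow> 'w \<Rightarrow> 'w" and p :: "'w \<Rightarrow> 'w"
  assumes act_add: "act x (w + w') = act x w + act x w'"
    and act_scale: "act x (t c w) = t c (act x w)"
    and add_act: "act (x + y) w = act x w + act y w"
    and scale_act: "act (s c x) w = t c (act x w)"
    and act_square: "act x (act x w) = t (q x) w"
    and p_add: "p (w + w') = p w + p w'"
    and p_scale: "p (t c w) = t c (p w)"
    and p_idem: "p (p w) = p w"
    and p_act: "p (act x w) = act x (w - p w)"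
    and nontrivial: "\<exists>w::'w. w \<noteq> 0"
begin

abbreviation ev :: "('v, 'f) free_alg \<Rightarrow> 'w \<Rightarrow> 'w" where "ev \<equiv> clifford_eval t act"
abbreviation I where "I \<equiv> clifford_ideal s q"

lemmas act_diff = additive_minus[of "act x" for x, OF act_add]
lemmas p_diff = additive_minus[of p, OF p_add]

lemma act_0: "act x 0 = 0" using act_add[of x 0 0] by simp
lemma p_0: "p 0 = 0" using p_add[of 0 0] by simp

lemma act_anticommute: "act x (act y w) + act y (act x w) = t (polar q x y) w"
proof -
  have "act (x + y) (act (x + y) w) = t (q (x + y)) w" by (rule act_square)
  then show ?thesis
    by (simp add: add_act act_add act_square polar_def W.scale_left_diff_distrib algebra_simps)
qed

lemma word_add: "foldr act l (w + w') = foldr act l w + foldr act l w'"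
  by (induction l) (simp_all add: act_add)

lemma word_scale: "foldr act l (t c w) = t c (foldr act l w)"
  by (induction l) (simp_all add: act_scale)

lemma ev_superset:
  "finite A \<Longrightarrow> Poly_Mapping.keys x \<subseteq> A \<Longrightarrow>
    ev x w = (\<Sum>m\<in>A. t (Poly_Mapping.lookup x m) (foldr act (letters m) w))"
  unfolding clifford_eval_def by (rule sum.mono_neutral_left) (auto simp: in_keys_iff)

lemma ev_add: "ev (x + y) w = ev x w + ev y w"
proof -
  let ?A = "Poly_Mapping.keys x \<union> Poly_Mapping.keys y"
  have "ev z w = (\<Sum>m\<in>?A. t (Poly_Mapping.lookup z m) (foldr act (letters m) w))"
    if "z \<in> {x, y, x + y}" for z
    using that Poly_Mapping.keys_add[of x y] by (intro ev_superset) auto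
  then show ?thesis by (simp add: lookup_add W.scale_left_distrib sum.distrib)
qed

lemma ev_0: "ev 0 w = 0" by (simp add: clifford_eval_def)
lemma ev_diff: "ev (x - y) w = ev x w - ev y w"
  using ev_add[of "x - y" y w] by simp
lemma ev_single: "ev (Poly_Mapping.single m c) w = t c (foldr act (letters m) w)"
  by (simp add: clifford_eval_def)
lemma ev_gen: "ev (free_gen x) w = act x w" by (simp add: free_gen_def ev_single)
lemma ev_scalar: "ev (free_scalar c) w = t c w" by (simp add: free_scalar_def ev_single)
lemma add_ev: "ev x (w + w') = ev x w + ev x w'"
  by (simp add: clifford_eval_def word_add W.scale_right_distrib sum.distrib)
lemma scale_ev: "ev x (t c w) = t c (ev x w)"
  by (simp add: clifford_eval_def word_scale W.scale_sum_right mult.commute)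
lemma zero_ev: "ev x 0 = 0" using add_ev[of x 0 0] by simp
lemmas diff_ev = additive_minus[of "ev x" for x, OF add_ev]

lemma ev_mult: "ev (x * y) w = ev x (ev y w)"
proof (induction x rule: free_alg_induct)
  case (single m c)
  show ?case
  proof (induction y rule: free_alg_induct)
    case (single n d)
    show ?case by (simp add: mult_single ev_single word_scale)
  qed (simp_all add: distrib_left ev_add ev_0 zero_ev add_ev)
qed (simp_all add: distrib_right ev_add ev_0)

text \<open>The elements acting as zero form a two-sided ideal, and the module axioms place the
  Clifford relations in it.\<close>

lemma ev_ideal: "x \<in> I \<Longrightarrow> ev x w = 0"
proof -
  let ?K = "{x. \<forall>w. ev x w = 0}"
  have "ideal ?K free_ring"
  proof (rule idealI[OF ring_free_ring])
    have inv: "inv\<^bsub>add_monoid free_ring\<^esub> y = - y" for y :: "('v, 'f) free_alg"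
      using free_ring_minus[of 0 y] by (simp add: a_minus_def a_inv_def)
    show "subgroup ?K (add_monoid free_ring)"
    proof (rule group.subgroupI[OF abelian_group.a_group[OF ring.is_abelian_group[OF ring_free_ring]]])
      have "0 \<in> ?K" by (simp add: ev_0)
      then show "?K \<noteq> {}" by blast
      show "inv\<^bsub>add_monoid free_ring\<^esub> y \<in> ?K" if "y \<in> ?K" for y
        unfolding inv using that ev_diff[of 0 y] by (simp add: ev_0)
      show "y \<otimes>\<^bsub>add_monoid free_ring\<^esub> z \<in> ?K" if "y \<in> ?K" "z \<in> ?K" for y z
        using that by (simp add: ev_add)
    qed simp
  qed (simp_all add: ev_mult zero_ev)
  moreover have "clifford_relations s q \<subseteq> ?K"
    by (auto simp: clifford_relations_def ev_diff ev_add ev_mult ev_gen ev_scalar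
      add_act scale_act act_square)
  ultimately have "I \<subseteq> ?K"
    unfolding clifford_ideal_def by (rule ring.genideal_minimal[OF ring_free_ring])
  then show "x \<in> I \<Longrightarrow> ev x w = 0" by blast
qed

end

section \<open>Normal forms in the Clifford algebra\<close>

text \<open>Combinations of ordered monomials using each list entry at most once, split by whether
  the first entry occurs. They are exact elements of the free algebra; the ideal enters only through
  \<open>reducible\<close>.\<close>

fun nform :: "'v list \<Rightarrow> ('v, 'f::field) free_alg set" where
  "nform [] = range free_scalar"
| "nform (e # es) = {b + free_gen e * c | b c. b \<in> nform es \<and> c \<in> nform es}"

lemma nform_ConsI: "b \<in> nform es \<Longrightarrow> c \<in> nform es \<Longrightarrow> b + free_gen e * c \<in> nform (e # es)"
  by auto

lemma nform_add: "x \<in> nform es \<Longrightarrow> y \<in> nform es \<Longrightarrow> x + y \<in> nform es"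
proof (induction es arbitrary: x y)
  case Nil
  then show ?case by (auto simp flip: free_scalar_simps)
next
  case (Cons e es)
  then obtain b c b' c' where "b \<in> nform es" "c \<in> nform es" "x = b + free_gen e * c"
    "b' \<in> nform es" "c' \<in> nform es" "y = b' + free_gen e * c'" by auto
  moreover from this have "x + y = (b + b') + free_gen e * (c + c')" by (simp add: algebra_simps)
  ultimately show ?case using Cons.IH by (simp only: nform_ConsI)
qed

lemma nform_scale: "x \<in> nform es \<Longrightarrow> free_scalar a * x \<in> nform es"
proof (induction es arbitrary: x)
  case Nil
  then show ?case by (auto simp flip: free_scalar_simps)
next
  case (Cons e es)
  then obtain b c where bc: "b \<in> nform es" "c \<in> nform es" "x = b + free_gen e * c" by auto
  have "free_scalar a * x = free_scalar a * b + free_gen e * (free_scalar a * c)"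
    unfolding bc by (simp add: distrib_left mult.assoc[symmetric] free_scalar_commute[of a "free_gen e"])
  then show ?case using bc Cons.IH by (simp only: nform_ConsI)
qed

lemma nform_0: "0 \<in> nform es"
proof (induction es)
  case Nil
  show ?case using free_scalar_simps(3) by (auto intro: rev_image_eqI)
next
  case (Cons e es)
  show ?case using nform_ConsI[OF Cons Cons, of e] by simp
qed

lemma nform_mono: "x \<in> nform es \<Longrightarrow> x \<in> nform (e # es)"
  using nform_ConsI[OF _ nform_0, of x es e] by simp

section \<open>Reduction to normal form modulo the Clifford ideal\<close>

definition reducible where
  "reducible s q es x \<longleftrightarrow> (\<exists>n\<in>nform es. x - n \<in> clifford_ideal s q)"

lemma clifford_ideal_neg: "x \<in> clifford_ideal s q \<Longrightarrow> - x \<in> clifford_ideal s q"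
  using clifford_ideal_lmult[of x s q "- 1"] by simp

lemma reducible_cong:
  assumes "reducible s q es x" "y - x \<in> clifford_ideal s q"
  shows "reducible s q es y"
proof -
  obtain n where n: "n \<in> nform es" "x - n \<in> clifford_ideal s q" using assms by (auto simp: reducible_def)
  have "(y - x) + (x - n) \<in> clifford_ideal s q" by (intro clifford_ideal_add assms n)
  then show ?thesis using n by (auto simp: reducible_def)
qed

lemma reducible_add:
  assumes "reducible s q es x" "reducible s q es y"
  shows "reducible s q es (x + y)"
proof -
  obtain n where n: "n \<in> nform es" "x - n \<in> clifford_ideal s q" using assms by (auto simp: reducible_def)
  obtain m where m: "m \<in> nform es" "y - m \<in> clifford_ideal s q" using assms by (auto simp: reducible_def)
  have "(x - n) + (y - m) \<in> clifford_ideal s q" by (intro clifford_ideal_add m n)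
  then have "(x + y) - (n + m) \<in> clifford_ideal s q" by (simp add: algebra_simps)
  then show ?thesis using n m nform_add unfolding reducible_def by blast
qed

lemma reducible_scale:
  assumes "reducible s q es x"
  shows "reducible s q es (free_scalar a * x)"
proof -
  obtain n where n: "n \<in> nform es" "x - n \<in> clifford_ideal s q" using assms by (auto simp: reducible_def)
  have "free_scalar a * x - free_scalar a * n \<in> clifford_ideal s q"
    using clifford_ideal_lmult[OF n(2), of "free_scalar a"] by (simp add: right_diff_distrib)
  then show ?thesis using n nform_scale unfolding reducible_def by blast
qed

lemma reducible_Cons:
  assumes "reducible s q es x" "reducible s q es y"
  shows "reducible s q (e # es) (x + free_gen e * y)"
proof -
  obtain n where n: "n \<in> nform es" "x - n \<in> clifford_ideal s q" using assms by (auto simp: reducible_def)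
  obtain m where m: "m \<in> nform es" "y - m \<in> clifford_ideal s q" using assms by (auto simp: reducible_def)
  have "(x - n) + free_gen e * (y - m) \<in> clifford_ideal s q"
    by (intro clifford_ideal_add clifford_ideal_lmult m n)
  then have "(x + free_gen e * y) - (n + free_gen e * m) \<in> clifford_ideal s q" by (simp add: algebra_simps)
  then show ?thesis using n m unfolding reducible_def by auto
qed

lemma rel_in_ideal:
  "free_gen (v + w) - (free_gen v + free_gen w) \<in> clifford_ideal s q"
  "free_gen (s c v) - free_scalar c * free_gen v \<in> clifford_ideal s q"
  "free_gen v * free_gen v - free_scalar (q v) \<in> clifford_ideal s q"
  using relations_subset[of s q] by (auto simp: clifford_relations_def)

lemma anticommute_in_ideal:
  "free_gen v * free_gen w + free_gen w * free_gen v - free_scalar (polar q v w) \<in> clifford_ideal s q"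
proof -
  let ?I = "clifford_ideal s q"
  note I = clifford_ideal_add clifford_ideal_lmult clifford_ideal_rmult clifford_ideal_neg
  have a: "free_gen (v + w) - (free_gen v + free_gen w) \<in> ?I" by (rule rel_in_ideal)
  \<comment> \<open>\<open>free_gen (v + w)\<close> and \<open>free_gen v + free_gen w\<close> agree
    only modulo the ideal; the two correction terms exchange them in the square, one factor at a
    time.\<close>
  have *: "(free_gen (v+w) * free_gen (v+w) - free_scalar (q (v + w)))
      + - ((free_gen (v + w) - (free_gen v + free_gen w)) * free_gen (v + w))
      + - ((free_gen v + free_gen w) * (free_gen (v + w) - (free_gen v + free_gen w)))
      + - (free_gen v * free_gen v - free_scalar (q v))
      + - (free_gen w * free_gen w - free_scalar (q w)) \<in> ?I"
    by (intro I rel_in_ideal)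
  have "free_scalar (q (v + w)) = free_scalar (polar q v w) + free_scalar (q v) + free_scalar (q w)"
    by (simp add: polar_def flip: free_scalar_simps)
  from *[unfolded this] show ?thesis by (simp add: algebra_simps)
qed

text \<open>Induction on the list: if \<open>e\<close> is the leading entry \<open>a\<close>, the
  square collapses to \<open>q a\<close>; otherwise \<open>e\<close> is moved past \<open>a\<close>
  by anticommutation and the induction hypothesis treats the tail.\<close>

lemma reducible_basis_mult:
  "e \<in> set es \<Longrightarrow> reducible s q es x \<Longrightarrow> reducible s q es (free_gen e * x)"
proof (induction es arbitrary: e x)
  case (Cons a es)
  let ?I = "clifford_ideal s q"
  obtain n where n: "n \<in> nform (a # es)" "x - n \<in> ?I" using Cons.prems by (auto simp: reducible_def)
  then obtain b c where bc: "b \<in> nform es" "c \<in> nform es" "n = b + free_gen a * c" by auto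
  have rb: "reducible s q es b" "reducible s q es c"
    using bc clifford_ideal_zero[of s q] unfolding reducible_def by force+
  have "reducible s q (a # es) (free_gen e * n)"
  proof (cases "e = a")
    case True
    have *: "reducible s q (a # es) (free_scalar (q a) * c + free_gen a * b)"
      by (intro reducible_Cons reducible_scale rb)
    have "free_gen e * n - (free_scalar (q a) * c + free_gen a * b) =
        (free_gen a * free_gen a - free_scalar (q a)) * c"
      by (simp add: bc True algebra_simps)
    then show ?thesis
      using reducible_cong[OF *] clifford_ideal_rmult[OF rel_in_ideal(3)[of a q s]] by simp
  next
    case False
    then have e: "e \<in> set es" using Cons.prems by simp
    have *: "reducible s q (a # es)
        ((free_gen e * b + free_scalar (polar q e a) * c) + free_gen a * (free_scalar (- 1) * (free_gen e * c)))"
      by (intro reducible_Cons reducible_scale reducible_add rb Cons.IH[OF e])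
    have "free_scalar (- 1) = (- 1 :: ('a, 'b) free_alg)"
      by (simp add: free_scalar_def single_uminus)
    then have "free_gen e * n -
        ((free_gen e * b + free_scalar (polar q e a) * c) + free_gen a * (free_scalar (- 1) * (free_gen e * c))) =
        (free_gen e * free_gen a + free_gen a * free_gen e - free_scalar (polar q e a)) * c"
      by (simp add: bc algebra_simps)
    then show ?thesis
      using reducible_cong[OF *] clifford_ideal_rmult[OF anticommute_in_ideal[of e a q s]] by simp
  qed
  moreover have "free_gen e * x - free_gen e * n \<in> ?I"
    using clifford_ideal_lmult[OF n(2), of "free_gen e"] by (simp add: right_diff_distrib)
  ultimately show ?case by (rule reducible_cong)
qed simp

lemma (in vector_space) reducible_gen_mult:
  assumes "v \<in> span (set es)" "reducible scale q es x"
  shows "reducible scale q es (free_gen v * x)"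
  using assms(1)
proof (induction v rule: span_induct_alt)
  case base
  \<comment> \<open>The generator of the zero vector is not \<open>0\<close> in the free algebra;
    scaling by \<open>0\<close> puts it into the ideal.\<close>
  have "free_gen (scale 0 0) - free_scalar 0 * free_gen 0 \<in> clifford_ideal scale q"
    by (rule rel_in_ideal)
  then have "free_gen 0 \<in> clifford_ideal scale q" by (simp add: free_scalar_simps)
  then have "free_gen 0 * x \<in> clifford_ideal scale q" by (rule clifford_ideal_rmult)
  then show ?case using nform_0 unfolding reducible_def by force
next
  case (step c e v)
  have "reducible scale q es (free_scalar c * (free_gen e * x) + free_gen v * x)"
    by (intro reducible_add reducible_scale reducible_basis_mult step assms)
  moreover have "(free_gen (scale c e + v) - (free_gen (scale c e) + free_gen v)) * x
      + (free_gen (scale c e) - free_scalar c * free_gen e) * x \<in> clifford_ideal scale q"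
    by (intro clifford_ideal_add clifford_ideal_rmult rel_in_ideal)
  then have "free_gen (scale c e + v) * x - (free_scalar c * (free_gen e * x) + free_gen v * x)
      \<in> clifford_ideal scale q"
    by (simp add: algebra_simps)
  ultimately show ?case by (rule reducible_cong)
qed

text \<open>A word arises by left multiplication with one letter at a time, and each letter lies in
  the span of \<open>es\<close>.\<close>

lemma (in vector_space) reducible_all:
  assumes "span (set es) = UNIV"
  shows "reducible scale q es x"
proof (induction x rule: free_alg_induct)
  case zero
  then show ?case using nform_0 clifford_ideal_zero unfolding reducible_def by force
next
  case (single w c)
  have one: "(1 :: ('b, 'a) free_alg) \<in> nform es"
  proof (induction es)
    case Nil
    then show ?case using free_scalar_simps(4) by (auto intro: rev_image_eqI)
  qed (rule nform_mono)
  have "reducible scale q es (Poly_Mapping.single (FM l) 1)" for l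
  proof (induction l)
    case Nil
    have "Poly_Mapping.single (FM []) 1 = (1 :: ('b, 'a) free_alg)"
      by (simp flip: zero_fmonoid_def)
    then show ?case using one clifford_ideal_zero[of scale q] unfolding reducible_def by force
  next
    case (Cons v l)
    have "Poly_Mapping.single (FM (v # l)) 1 = free_gen v * Poly_Mapping.single (FM l) (1::'a)"
      by (simp add: free_gen_def mult_single plus_fmonoid_def)
    then show ?case using Cons reducible_gen_mult[of v es] assms by simp
  qed
  from reducible_scale[OF this[of "letters w"], of c] show ?case
    by (simp add: free_scalar_def mult_single)
next
  case (add x y)
  then show ?case by (rule reducible_add)
qed

text \<open>Nonsingularity represents each coordinate functional by a vector. A dual pair replaces
  an orthogonal basis, since in characteristic two the polar form is alternating.\<close>

lemma (in nonsingular_quadratic_space) dual_basis: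
  obtains es f where "distinct es" "independent (set es)" "span (set es) = UNIV"
    "length es = dim UNIV"
    "\<And>e e'. e \<in> set es \<Longrightarrow> e' \<in> set es \<Longrightarrow> polar q (f e) e' = (if e = e' then 1 else 0)"
proof -
  obtain B0 where B0: "finite B0" "span B0 = UNIV" using finite_dim by blast
  obtain B where B: "B \<subseteq> B0" "independent B" "B0 \<subseteq> span B"
    using maximal_independent_subset[of B0] by blast
  have finB: "finite B" using B B0 finite_subset by blast
  have spanB: "span B = UNIV"
    using B(3) B0(2) by (metis span_mono span_span top.extremum_uniqueI)
  obtain es where es: "set es = B" "distinct es" using finite_distinct_list[OF finB] by blast
  have "\<exists>y. \<forall>x. polar q x y = representation B x e" for e
  proof -
    have "Vector_Spaces.linear scale (*) (\<lambda>x. representation B x e)"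
      unfolding Vector_Spaces.linear_iff
      by (intro conjI vector_space_axioms)
        (auto simp: representation_add representation_scale B spanB vector_space_def algebra_simps)
    from functional_ex1[OF this] show ?thesis by blast
  qed
  then obtain f where f: "\<And>e x. polar q x (f e) = representation B x e" by metis
  have "polar q (f e) e' = (if e = e' then 1 else 0)" if "e \<in> set es" "e' \<in> set es" for e e'
  proof -
    have "polar q (f e) e' = polar q e' (f e)" by (simp add: polar_def add.commute)
    then show ?thesis using that es by (auto simp: f representation_basis B)
  qed
  moreover have "length es = dim UNIV"
    using B(2) spanB es dim_eq_card[of B UNIV] by (simp add: distinct_card[symmetric])
  ultimately show ?thesis using that es B(2) spanB by metis
qed

section \<open>Faithfulness and density\<close>

context clifford_module
begin

text \<open>Conjugation by \<open>J\<close> is the grading automorphism of the operators, so the graded commutator with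
  \<open>act f\<close> is an antiderivation; applied to a normal form it isolates the coefficient of the basis
  vector dual to \<open>f\<close>.\<close>

definition J where "J w = p w + p w - w"

lemma J_add: "J (w + w') = J w + J w'" by (simp add: J_def p_add)
lemma J_0: "J 0 = 0" using J_add[of 0 0] by simp
lemma J_scale: "J (t c w) = t c (J w)"
  by (simp add: J_def p_scale W.scale_right_distrib W.scale_right_diff_distrib)
lemma J_J: "J (J w) = w" by (simp add: J_def p_add p_diff p_idem)
lemma J_act: "J (act x w) = - act x (J w)"
  by (simp add: J_def p_act act_diff act_add algebra_simps)

text \<open>Both \<open>act f\<close> and \<open>J\<close> anticommute with every letter of
  \<open>n\<close>, so moving \<open>act f\<close> through \<open>n\<close> amounts to conjugating
  \<open>n\<close> by \<open>J\<close>.\<close>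

lemma nform_graded_commute:
  assumes "n \<in> nform es" "\<And>e. e \<in> set es \<Longrightarrow> polar q f e = 0"
  shows "act f (ev n w) = J (ev n (J (act f w)))"
  using assms
proof (induction es arbitrary: n w)
  case Nil
  then obtain c where "n = free_scalar c" by auto
  then show ?case by (simp add: ev_scalar act_scale J_scale J_J)
next
  case (Cons e es)
  then obtain b c where bc: "b \<in> nform es" "c \<in> nform es" "n = b + free_gen e * c" by auto
  have ih: "act f (ev b w) = J (ev b (J (act f w)))" "act f (ev c w) = J (ev c (J (act f w)))" for w
    using Cons.IH[OF bc(1)] Cons.IH[OF bc(2)] Cons.prems by auto
  have "act f (act e (ev c w)) = - act e (act f (ev c w))"
    using act_anticommute[of f e "ev c w"] Cons.prems by (simp add: eq_neg_iff_add_eq_0)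
  then show ?case
    by (simp add: bc ev_add ev_mult ev_gen act_add J_add ih J_act)
qed

lemma nform_Cons_eq_0:
  assumes "b \<in> nform es" "c \<in> nform es" "\<And>w. ev b w + act e (ev c w) = 0"
    and f: "\<And>e'. e' \<in> set es \<Longrightarrow> polar q f e' = 0" "polar q f e = 1"
  shows "ev b w = 0" "ev c w = 0"
proof -
  have c: "ev c w = 0" for w
  proof -
    \<comment> \<open>The hypothesis is used twice: at \<open>J (act f w)\<close> followed by
      \<open>J\<close>, and at \<open>w\<close> followed by \<open>act f\<close>. The difference is
      \<open>polar q f e = 1\<close> times \<open>ev c w\<close>.\<close>
    have "J (ev b (J (act f w)) + act e (ev c (J (act f w)))) = 0"
      by (simp add: assms J_0)
    then have 1: "J (ev b (J (act f w))) = act e (J (ev c (J (act f w))))"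
      by (simp add: J_add J_act)
    have "act f (ev b w + act e (ev c w)) = 0" by (simp add: assms act_0)
    then have "J (ev b (J (act f w))) + act f (act e (ev c w)) = 0"
      by (simp add: act_add nform_graded_commute[OF assms(1) f(1)])
    then have "act e (act f (ev c w)) + act f (act e (ev c w)) = 0"
      unfolding 1 by (simp add: nform_graded_commute[OF assms(2) f(1)])
    then show ?thesis
      using act_anticommute[of f e "ev c w"] f(2) by (simp add: add.commute)
  qed
  then show "ev c w = 0" .
  show "ev b w = 0" using assms(3)[of w] by (simp add: c act_0)
qed

lemma nform_ev_inj:
  assumes "distinct es"
    and "\<And>e e'. e \<in> set es \<Longrightarrow> e' \<in> set es \<Longrightarrow> polar q (f e) e' = (if e = e' then 1 else 0)"
    and "n \<in> nform es" "\<And>w. ev n w = 0"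
  shows "n = 0"
  using assms
proof (induction es arbitrary: n)
  case Nil
  then obtain c where c: "n = free_scalar c" by auto
  obtain w :: 'w where "w \<noteq> 0" using nontrivial by blast
  moreover have "t c w = 0" using Nil(4)[of w] by (simp add: c ev_scalar)
  ultimately show ?case by (simp add: c free_scalar_simps)
next
  case (Cons e es)
  then obtain b c where bc: "b \<in> nform es" "c \<in> nform es" "n = b + free_gen e * c" by auto
  have *: "ev b w + act e (ev c w) = 0" for w
    using Cons.prems(4)[of w] by (simp add: bc ev_add ev_mult ev_gen)
  have f: "polar q (f e) e' = 0" if "e' \<in> set es" for e'
    using Cons.prems(1,2) that by auto
  have fe: "polar q (f e) e = 1" using Cons.prems(2) by simp
  have "b = 0" "c = 0"
    using nform_Cons_eq_0[OF bc(1,2) * f fe] Cons.prems by (auto intro!: Cons.IH bc(1,2))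
  then show ?case by (simp add: bc)
qed

text \<open>An element acting as zero reduces to a normal form acting as zero, and that vanishes.
  Equality in the Clifford algebra can thus be tested on any such module, including the twisted one
  below.\<close>

lemma ev_kernel: "x \<in> I \<longleftrightarrow> (\<forall>w. ev x w = 0)"
proof
  assume 0: "\<forall>w. ev x w = 0"
  obtain es f where es: "distinct es" "V.span (set es) = UNIV"
    "\<And>e e'. e \<in> set es \<Longrightarrow> e' \<in> set es \<Longrightarrow> polar q (f e) e' = (if e = e' then 1 else 0)"
    using V.dual_basis by metis
  obtain n where n: "n \<in> nform es" "x - n \<in> I"
    using V.reducible_all[OF es(2), of q x] unfolding reducible_def by blast
  have "ev n w = 0" for w using ev_ideal[OF n(2), of w] 0 by (simp add: ev_diff)
  then have "n = 0" using nform_ev_inj[OF es(1,3) n(1)] by blast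
  then show "x \<in> I" using n by simp
qed (simp add: ev_ideal)

end

section \<open>Independence of the monomial operators and density by counting\<close>

lemma sum_apply: "(\<Sum>i\<in>A. f i) x = (\<Sum>i\<in>A. f i x)"
  for f :: "'i \<Rightarrow> 'a \<Rightarrow> 'b::ab_group_add"
  by (induction A rule: infinite_finite_induct) simp_all

text \<open>The doubling step for monomials, with \<open>L\<close> the composition with one more
  letter. Applied to negatives and differences, \<open>inj\<close> also yields disjointness and
  injectivity on \<open>B\<close>.\<close>

lemma (in vector_space) independent_Un_image:
  assumes B: "finite B" "independent B"
    and L: "Vector_Spaces.linear scale scale L"
    and inj: "\<And>b c. b \<in> span B \<Longrightarrow> c \<in> span B \<Longrightarrow> b + L c = 0 \<Longrightarrow> b = 0 \<and> c = 0"
  shows "independent (B \<union> L ` B)" "card (B \<union> L ` B) = 2 * card B" "finite (B \<union> L ` B)"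
proof -
  interpret L: Vector_Spaces.linear scale scale L by (rule L)
  have disj: "B \<inter> L ` B = {}"
  proof (rule ccontr)
    assume "B \<inter> L ` B \<noteq> {}"
    then obtain b c where bc: "b \<in> B" "c \<in> B" "b = L c" by auto
    have "- b + L c = 0" using bc by simp
    then have "c = 0" using inj[of "- b" c] bc by (simp add: span_base span_neg)
    then show False using bc B(2) dependent_zero by blast
  qed
  have injL: "inj_on L B"
  proof (rule inj_onI)
    fix b c assume "b \<in> B" "c \<in> B" "L b = L c"
    then have "0 + L (b - c) = 0" "b - c \<in> span B" by (simp_all add: L.diff span_base span_diff)
    then show "b = c" using inj[of 0 "b - c"] span_zero by simp
  qed
  show "finite (B \<union> L ` B)" using B by simp
  show "card (B \<union> L ` B) = 2 * card B"
    using B disj by (simp add: card_Un_disjoint card_image[OF injL])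
  have "\<forall>v\<in>B \<union> L ` B. u v = 0" if u: "(\<Sum>v\<in>B \<union> L ` B. scale (u v) v) = 0" for u
  proof -
    let ?b = "\<Sum>v\<in>B. scale (u v) v" and ?c = "\<Sum>v\<in>B. scale (u (L v)) v"
    have "?b + L ?c = 0"
      using u B disj by (simp add: sum.union_disjoint sum.reindex[OF injL] L.sum L.scale)
    moreover have "?b \<in> span B" "?c \<in> span B" by (intro span_sum span_scale span_base; simp)+
    ultimately have "?b = 0" "?c = 0" using inj by blast+
    then show ?thesis
      using independentD[OF B(2,1) subset_refl, of u]
        independentD[OF B(2,1) subset_refl, of "\<lambda>v. u (L v)"] by auto
  qed
  then show "independent (B \<union> L ` B)" using B by (auto simp: dependent_finite)
qed

context clifford_module
begin

abbreviation op_scale :: "'f \<Rightarrow> ('w \<Rightarrow> 'w) \<Rightarrow> 'w \<Rightarrow> 'w" where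
  "op_scale c T \<equiv> \<lambda>w. t c (T w)"

text \<open>The ambient space consists of all functions on the module, linear or not, so dimensions
  are bounded through explicit spanning sets of operators.\<close>

sublocale Op: vector_space op_scale
  by standard (auto simp: fun_eq_iff W.scale_right_distrib W.scale_left_distrib)

fun monomials :: "'v list \<Rightarrow> ('w \<Rightarrow> 'w) set" where
  "monomials [] = {id}"
| "monomials (e # es) = monomials es \<union> (\<circ>) (act e) ` monomials es"

lemma monomials_ev: "T \<in> monomials es \<Longrightarrow> \<exists>n\<in>nform es. T = ev n"
proof (induction es arbitrary: T)
  case Nil
  have "T = ev (free_scalar 1)" using Nil by (simp add: fun_eq_iff ev_scalar)
  then show ?case by auto
next
  case (Cons e es)
  from Cons.prems consider "T \<in> monomials es" | S where "S \<in> monomials es" "T = act e \<circ> S" by auto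
  then show ?case
  proof cases
    case 1
    then obtain n where "n \<in> nform es" "T = ev n" using Cons.IH by blast
    then show ?thesis by (intro bexI[of _ n] nform_mono)
  next
    case 2
    then obtain n where "n \<in> nform es" "S = ev n" using Cons.IH by blast
    then show ?thesis
      using nform_ConsI[OF nform_0, of n es e] 2
      by (intro bexI[of _ "free_gen e * n"]) (auto simp: fun_eq_iff ev_mult ev_gen)
  qed
qed

lemma span_monomials_ev: "T \<in> Op.span (monomials es) \<Longrightarrow> \<exists>n\<in>nform es. T = ev n"
proof (induction T rule: Op.span_induct_alt)
  case base
  show ?case by (rule bexI[OF _ nform_0]) (auto simp: fun_eq_iff ev_0)
next
  case (step c S T)
  obtain n where n: "n \<in> nform es" "S = ev n" using step monomials_ev by blast
  obtain m where m: "m \<in> nform es" "T = ev m" using step by blast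
  show ?case
    using n m by (intro bexI[of _ "free_scalar c * n + m"])
      (auto simp: fun_eq_iff ev_add ev_mult ev_scalar intro!: nform_add nform_scale)
qed

text \<open>By \<open>nform_Cons_eq_0\<close> each new basis vector contributes an independent copy
  of the previous monomials.\<close>

lemma monomials_independent:
  assumes "distinct es"
    and "\<And>e e'. e \<in> set es \<Longrightarrow> e' \<in> set es \<Longrightarrow> polar q (f e) e' = (if e = e' then 1 else 0)"
  shows "Op.independent (monomials es) \<and> card (monomials es) = 2 ^ length es \<and> finite (monomials es)"
  using assms
proof (induction es)
  case Nil
  obtain w :: 'w where "w \<noteq> 0" using nontrivial by blast
  then have "id \<noteq> (0 :: 'w \<Rightarrow> 'w)" by (auto simp: fun_eq_iff)
  then show ?case by simp
next
  case (Cons e es)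
  have ih: "Op.independent (monomials es)" "card (monomials es) = 2 ^ length es" "finite (monomials es)"
    using Cons by auto
  have f: "polar q (f e) e' = 0" if "e' \<in> set es" for e'
    using Cons.prems that by auto
  have fe: "polar q (f e) e = 1" using Cons.prems(2) by simp
  have "S = 0 \<and> T = 0" if S: "S \<in> Op.span (monomials es)" and T: "T \<in> Op.span (monomials es)"
    and 0: "S + (\<circ>) (act e) T = 0" for S T
  proof -
    obtain b where b: "b \<in> nform es" "S = ev b" using span_monomials_ev[OF S] by blast
    obtain c where c: "c \<in> nform es" "T = ev c" using span_monomials_ev[OF T] by blast
    have *: "ev b w + act e (ev c w) = 0" for w
      using fun_cong[OF 0, of w] by (simp add: b c)
    show ?thesis using nform_Cons_eq_0[OF b(1) c(1) * f fe] by (simp add: b c fun_eq_iff)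
  qed
  moreover have "Vector_Spaces.linear op_scale op_scale ((\<circ>) (act e))"
    unfolding Vector_Spaces.linear_iff
    by (auto simp: fun_eq_iff act_add act_scale Op.vector_space_axioms)
  ultimately show ?case
    using Op.independent_Un_image[OF ih(3,1), of "(\<circ>) (act e)"] ih by auto
qed

text \<open>The linear operators are spanned by \<open>card B * card B\<close> matrix units, at most
  as many as there are independent monomials; a \<open>T\<close> outside the span of the monomials
  would give one independent operator too many.\<close>

lemma ev_surj:
  assumes S: "finite S" "W.span S = UNIV" "(card S)\<^sup>2 \<le> 2 ^ V.dim UNIV"
    and T: "Vector_Spaces.linear t t T"
  shows "\<exists>x. T = ev x"
proof -
  interpret T: Vector_Spaces.linear t t T by (rule T)
  obtain B where B: "B \<subseteq> S" "W.independent B" "S \<subseteq> W.span B"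
    using W.maximal_independent_subset[of S] by blast
  have spanB: "W.span B = UNIV"
    using B(3) S(2) by (metis W.span_mono W.span_span top.extremum_uniqueI)
  have finB: "finite B" using B S finite_subset by blast
  have cardB: "card B * card B \<le> 2 ^ V.dim UNIV"
    using S(3) card_mono[OF S(1) B(1)] by (metis mult_le_mono order_trans power2_eq_square)
  define r where "r b w = W.representation B w b" for b w
  have r: "(\<Sum>b\<in>B. t (r b w) b) = w" for w
    unfolding r_def by (rule W.sum_representation_eq) (use B spanB finB in auto)
  \<comment> \<open>\<open>E (b, b')\<close> is the matrix unit sending \<open>b\<close> to
    \<open>b'\<close> and the rest of the basis to zero.\<close>
  define E where "E = (\<lambda>(b, b') w. t (r b w) b')"
  have E_span: "L \<in> Op.span (E ` (B \<times> B))" if "Vector_Spaces.linear t t L" for L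
  proof -
    interpret L: Vector_Spaces.linear t t L by (rule that)
    have *: "L w = (\<Sum>b\<in>B. \<Sum>b'\<in>B. t (r b' (L b)) (E (b, b') w))" for w
    proof -
      have "L w = L (\<Sum>b\<in>B. t (r b w) b)" by (simp add: r)
      also have "\<dots> = (\<Sum>b\<in>B. t (r b w) (L b))" by (simp add: L.sum L.scale)
      also have "\<dots> = (\<Sum>b\<in>B. t (r b w) (\<Sum>b'\<in>B. t (r b' (L b)) b'))" by (simp add: r)
      finally show ?thesis by (simp add: E_def W.scale_sum_right mult.commute)
    qed
    have "L = (\<Sum>b\<in>B. \<Sum>b'\<in>B. op_scale (r b' (L b)) (E (b, b')))"
      by (rule ext, subst *) (simp add: sum_apply)
    also have "\<dots> \<in> Op.span (E ` (B \<times> B))"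
      by (intro Op.span_sum Op.span_scale Op.span_base) auto
    finally show ?thesis .
  qed
  obtain es f where es: "distinct es" "length es = V.dim UNIV"
    "\<And>e e'. e \<in> set es \<Longrightarrow> e' \<in> set es \<Longrightarrow> polar q (f e) e' = (if e = e' then 1 else 0)"
    using V.dual_basis by metis
  have M: "Op.independent (monomials es)" "card (monomials es) = 2 ^ V.dim UNIV" "finite (monomials es)"
    using monomials_independent[OF es(1,3)] es(2) by auto
  have lin_ev: "Vector_Spaces.linear t t (ev x)" for x
    unfolding Vector_Spaces.linear_iff by (simp add: add_ev scale_ev W.vector_space_axioms)
  have "T \<in> Op.span (monomials es)"
  proof (rule ccontr)
    assume n: "T \<notin> Op.span (monomials es)"
    then have ind: "Op.independent (insert T (monomials es))" using M(1) by (rule Op.independent_insertI)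
    have "insert T (monomials es) \<subseteq> Op.span (E ` (B \<times> B))"
      using E_span[OF T] E_span[OF lin_ev] monomials_ev by blast
    then have "card (insert T (monomials es)) \<le> card (E ` (B \<times> B))"
      using Op.independent_span_bound[OF _ ind, of "E ` (B \<times> B)"] finB by simp
    also have "\<dots> \<le> card B * card B" using card_image_le[of "B \<times> B" E] finB by (simp add: card_cartesian_product)
    finally have "card (insert T (monomials es)) \<le> 2 ^ V.dim UNIV" using cardB by simp
    moreover have "T \<notin> monomials es" using n Op.span_base by blast
    ultimately show False using M by simp
  qed
  then show ?thesis using span_monomials_ev by blast
qed

end

section \<open>Intertwiners\<close>

locale clifford_module_similitude = clifford_module s q t act p
  for s :: "'f::field \<Rightarrow> 'v::ab_group_add \<Rightarrow> 'v" and q :: "'v \<Rightarrow> 'f"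
    and t :: "'f \<Rightarrow> 'w::ab_group_add \<Rightarrow> 'w" and act p +
  fixes g :: "'v \<Rightarrow> 'v"
  assumes g_proper: "g \<in> GO_plus s q"
begin

definition m where "m = multiplier q g"

lemma g_GO: "g \<in> GO s q" using g_proper by (simp add: GO_plus_def)
lemma m: "m \<noteq> 0" "q (g x) = m * q x" using multiplier[OF g_GO] by (simp_all add: m_def)
lemma g_add: "g (x + y) = g x + g y" and g_scale: "g (s c x) = s c (g x)"
  using g_GO by (simp_all add: GO_def Vector_Spaces.linear_iff)

text \<open>The scalar \<open>inverse m\<close> on one summand makes the twisted action satisfy
  the Clifford relations of \<open>q\<close> itself.\<close>

definition act' where
  "act' x w = act (g x) (p w) + t (inverse m) (act (g x) (w - p w))"

sublocale twisted: clifford_module s q t act' p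
proof
  show "act' x (w + w') = act' x w + act' x w'" for x w w'
    by (simp add: act'_def p_add act_add act_diff W.scale_right_distrib W.scale_right_diff_distrib)
  show "act' x (t c w) = t c (act' x w)" for x c w
    by (simp add: act'_def p_scale act_scale act_diff W.scale_right_distrib W.scale_right_diff_distrib mult.commute)
  show "act' (x + y) w = act' x w + act' y w" for x y w
    by (simp add: act'_def g_add add_act W.scale_right_distrib)
  show "act' (s c x) w = t c (act' x w)" for x c w
    by (simp add: act'_def g_scale scale_act W.scale_right_distrib mult.commute)
  show "p (act' x w) = act' x (w - p w)" for x w
    by (simp add: act'_def p_add p_diff p_scale p_idem p_act act_0)
  show "act' x (act' x w) = t (q x) w" for x w
  proof -
    \<comment> \<open>\<open>?u\<close> and \<open>?v\<close> are the components of
      \<open>act' x w\<close> in the kernel and the image of \<open>p\<close>; the second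
      application rescales only the former.\<close>
    let ?u = "act (g x) (p w)" and ?v = "t (inverse m) (act (g x) (w - p w))"
    have "p ?u = 0" "p ?v = ?v" by (simp_all add: p_act p_scale p_diff p_idem act_0)
    then have "act' x (?u + ?v) = act (g x) ?v + t (inverse m) (act (g x) ?u)"
      by (simp add: act'_def p_add)
    also have "\<dots> = t (inverse m * q (g x)) (w - p w) + t (inverse m * q (g x)) (p w)"
      by (simp add: act_scale act_square)
    also have "inverse m * q (g x) = q x" using m by simp
    finally show ?thesis by (simp add: act'_def W.scale_right_diff_distrib)
  qed
qed (use p_add p_scale p_idem nontrivial in auto)

section \<open>The twisted action on even elements\<close>

lemma twist_gens: "twist m g (free_gen x * free_gen y) =
    free_scalar (inverse m) * (free_gen (g x) * free_gen (g y))"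
  using twist_mult(3)[of m g "free_gen x" "free_gen y"]
  by (simp add: free_gen_def odd_part_simps twist_simps)

lemma twist_scalar: "twist m g (free_scalar c) = free_scalar c"
  by (simp add: free_scalar_def twist_simps zero_fmonoid_def)

lemma twist_even_mult: "x \<in> free_even \<Longrightarrow> twist m g (x * y) = twist m g x * twist m g y"
  using twist_mult(1)[of m g x y] by (simp add: even_part_free_even)

text \<open>A twisted letter exchanges the summands and carries \<open>inverse m\<close> on only one
  of them, so two letters pick it up exactly once, as \<open>twist\<close> does.\<close>

lemma twisted_ev_even: "x \<in> free_even \<Longrightarrow> twisted.ev x w = ev (twist m g x) w"
proof (induction x arbitrary: w rule: free_even_induct)
  case (gens x y)
  let ?u = "act (g y) (p w)" and ?v = "t (inverse m) (act (g y) (w - p w))"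
  have "p ?u = 0" "p ?v = ?v" by (simp_all add: p_act p_scale p_diff p_idem act_0)
  then have "act' x (?u + ?v) = act (g x) ?v + t (inverse m) (act (g x) ?u)"
    by (simp add: act'_def p_add)
  also have "\<dots> = t (inverse m) (act (g x) (act (g y) w))"
    by (simp add: act_scale act_diff W.scale_right_diff_distrib)
  finally show ?case
    by (simp add: twisted.ev_mult twisted.ev_gen twist_gens ev_mult ev_gen ev_scalar
        act'_def[of y])
qed (simp_all add: twisted.ev_scalar ev_scalar twist_scalar twisted.ev_add ev_add twist_simps
    twisted.ev_mult ev_mult twist_even_mult)

lemma ev_even_p:
  assumes "x \<in> free_even"
  shows "p (ev x w) = ev x (p w)"
  using assms
proof (induction x arbitrary: w rule: free_even_induct)
  case (gens x y)
  have "p (act x (act y w)) = act x (act y w - p (act y w))" by (rule p_act)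
  also have "\<dots> = act x (act y (p w))" by (simp add: p_act act_diff)
  finally show ?case by (simp add: ev_mult ev_gen)
qed (simp_all add: ev_scalar p_scale ev_add p_add ev_mult)

text \<open>Makes the automorphism computable: scalars and products of two generators generate the
  even part, and both sides agree on them.\<close>

lemma even_clifford_aut_proj:
  assumes "x \<in> free_even"
  shows "even_clifford_aut s q g (clifford_proj s q x) = clifford_proj s q (twist m g x)"
proof -
  let ?\<phi> = "even_clifford_aut s q g" and ?p = "clifford_proj s q" and ?E = "even_clifford s q"
  have \<phi>: "is_even_clifford_aut s q g ?\<phi>" by (rule even_clifford_aut[OF g_GO])
  then have hom: "?\<phi> \<in> ring_hom ?E ?E" by (auto simp: is_even_clifford_aut_def ring_iso_def)
  show ?thesis
    using assms
  proof (induction x rule: free_even_induct)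
    case (scalar c)
    then show ?case using \<phi> by (simp add: is_even_clifford_aut_def twist_scalar flip: clifford_scalar_def)
  next
    case (gens v w)
    then show ?case using \<phi>
      by (simp add: is_even_clifford_aut_def twist_gens[unfolded m_def] clifford_proj_simps m_def
          flip: clifford_vec_def clifford_scalar_def)
  next
    case (add x y)
    then show ?case
      using ring_hom_add[OF hom, of "?p x" "?p y"] by (simp add: clifford_proj_simps twist_simps)
  next
    case (mult x y)
    then show ?case
      using ring_hom_mult[OF hom, of "?p x" "?p y"] by (simp add: clifford_proj_simps twist_even_mult)
  qed
qed

text \<open>The projection \<open>p\<close> is the action of a central element of the even Clifford algebra, which
  a proper similitude fixes; hence \<open>p\<close> is also its action in the twisted module.\<close>

lemma proj_central:
  assumes S: "finite S" "W.span S = UNIV" "(card S)\<^sup>2 \<le> 2 ^ V.dim UNIV"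
  obtains c where "\<And>w. ev c w = p w" "\<And>w. twisted.ev c w = p w"
proof -
  have "Vector_Spaces.linear t t p"
    unfolding Vector_Spaces.linear_iff by (simp add: p_add p_scale W.vector_space_axioms)
  then obtain x where x: "p = ev x" using ev_surj[OF S] by blast
  define c where "c = even_part x"
  \<comment> \<open>An odd element exchanges the image and the kernel of \<open>p\<close>, so it
    cannot contribute to \<open>p\<close>, which preserves both.\<close>
  have odd: "p (ev (odd_part x) w) = ev (odd_part x) (w - p w)" for w
  proof (induction x arbitrary: w rule: free_alg_induct)
    case (single u d)
    have "p (foldr act l w) = (if even (length l) then foldr act l (p w) else foldr act l (w - p w))" for l
    proof (induction l)
      case (Cons a l)
      have "p (foldr act (a # l) w) = act a (foldr act l w) - act a (p (foldr act l w))"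
        by (simp add: p_act act_diff)
      then show ?case
        using word_add[of l "w - p w" "p w"] by (auto simp: Cons act_add)
    qed simp
    then show ?case by (simp add: odd_part_simps ev_single ev_0 p_0 p_scale)
  qed (simp_all add: odd_part_simps ev_0 p_0 ev_add p_add)
  have c_even: "c \<in> free_even" by (simp add: c_def even_part_in_free_even)
  have parts: "x = even_part x + odd_part x"
    by (induction x rule: free_alg_induct) (simp_all add: even_part_simps odd_part_simps algebra_simps)
  have pc: "p w = ev c w + ev (odd_part x) w" for w
    unfolding c_def ev_add[symmetric] parts[symmetric] by (simp add: x)
  have "p (ev (odd_part x) (p w)) = 0" for w by (simp add: odd p_idem zero_ev)
  then have c1: "ev c (p w) = p w" for w
    using arg_cong[OF pc[of "p w"], of p] ev_even_p[OF c_even, of "p w"] by (simp add: p_idem p_add)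
  have c2: "ev c (w - p w) = 0" for w
  proof -
    define u where "u = w - p w"
    have u: "p u = 0" by (simp add: u_def p_diff p_idem)
    have "p (ev c u) = 0" by (simp add: ev_even_p[OF c_even] u zero_ev)
    moreover have "p (ev (odd_part x) u) = ev (odd_part x) u" by (simp add: odd u)
    moreover have "ev c u + ev (odd_part x) u = 0" using pc[of u] u by simp
    ultimately have "ev (odd_part x) u = 0"
      using p_add[of "ev c u" "ev (odd_part x) u"] by (simp add: p_0)
    then show ?thesis using \<open>ev c u + ev (odd_part x) u = 0\<close> by (simp add: u_def)
  qed
  have c: "ev c w = p w" for w
    using c1[of w] c2[of w] by (simp add: diff_ev)
  have "clifford_proj s q c \<in> ring_center (even_clifford s q)"
  proof -
    \<comment> \<open>Faithfulness reduces centrality to operators: \<open>c\<close> acts as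
      \<open>p\<close>, which commutes with even elements.\<close>
    have "c * d - d * c \<in> I" if "d \<in> free_even" for d
      by (simp add: ev_kernel ev_diff ev_mult c ev_even_p[OF that])
    then show ?thesis
      using c_even by (auto simp: ring_center_def clifford_proj_eq_iff simp flip: clifford_proj_simps)
  qed
  \<comment> \<open>Properness of \<open>g\<close> enters here.\<close>
  then have "clifford_proj s q (twist m g c) = clifford_proj s q c"
    using g_proper by (simp add: GO_plus_def even_clifford_aut_proj[OF c_even, symmetric])
  then have "ev (twist m g c) w = ev c w" for w
    using ev_ideal[of "twist m g c - c" w] by (simp add: clifford_proj_eq_iff ev_diff)
  then have "twisted.ev c w = p w" for w by (simp add: twisted_ev_even[OF c_even] c)
  with c that show ?thesis by blast
qed

text \<open>The elements acting as \<open>t (\<beta> w) v\<close> on \<open>w\<close> form, modulo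
  the ideal, a left ideal that is a copy of the module; evaluating it at one vector of the twisted
  module gives \<open>h\<close>.\<close>

theorem intertwiner:
  assumes S: "finite S" "W.span S = UNIV" "(card S)\<^sup>2 \<le> 2 ^ V.dim UNIV"
  obtains h where "Vector_Spaces.linear t t h" "inj h" "\<And>x w. h (act x w) = act' x (h w)"
    "\<And>w. h (p w) = p (h w)"
proof -
  obtain v0 :: 'w where v0: "v0 \<noteq> 0" using nontrivial by blast
  obtain \<beta> :: "'w \<Rightarrow> 'f" where \<beta>: "Vector_Spaces.linear t (*) \<beta>" "\<beta> v0 = 1"
  proof -
    interpret P: vector_space_pair t "(*) :: 'f \<Rightarrow> 'f \<Rightarrow> 'f"
      by (intro vector_space_pair.intro W.vector_space_axioms) (unfold_locales; simp add: algebra_simps)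
    have "W.independent {v0}" using v0 by simp
    from P.linear_independent_extend[OF this, of "\<lambda>_. 1"] show ?thesis using that by auto
  qed
  have \<beta>_lin: "\<beta> (v + w) = \<beta> v + \<beta> w" "\<beta> (t c v) = c * \<beta> v" for v w c
    using \<beta>(1) by (simp_all add: Vector_Spaces.linear_iff)
  have "\<exists>x. \<forall>w. ev x w = t (\<beta> w) v" for v
  proof -
    have "Vector_Spaces.linear t t (\<lambda>w. t (\<beta> w) v)"
      unfolding Vector_Spaces.linear_iff
      by (simp add: \<beta>_lin W.scale_left_distrib W.vector_space_axioms)
    from ev_surj[OF S this] show ?thesis by (metis (no_types))
  qed
  then obtain k where k: "\<And>v w. ev (k v) w = t (\<beta> w) v" by metis
  \<comment> \<open>Since \<open>k v0\<close> is nonzero in the Clifford algebra, the faithful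
    twisted module has a vector that it does not kill.\<close>
  have "k v0 \<notin> I" using k[of v0 v0] v0 \<beta>(2) ev_ideal[of "k v0" v0] by auto
  then obtain w0 where w0: "twisted.ev (k v0) w0 \<noteq> 0" using twisted.ev_kernel by blast
  define h where "h v = twisted.ev (k v) w0" for v
  \<comment> \<open>The value depends only on the action of the representative, so products and sums
    of elements \<open>k v\<close> may be used instead.\<close>
  have h_eq: "h v = twisted.ev x w0" if "\<And>w. ev x w = t (\<beta> w) v" for v x
  proof -
    have "k v - x \<in> I" by (simp add: ev_kernel ev_diff k that)
    from twisted.ev_ideal[OF this, of w0] show ?thesis by (simp add: h_def twisted.ev_diff)
  qed
  have h_ev: "h (ev x w) = twisted.ev x (h w)" for x w
    by (subst h_eq[of "x * k w"]) (simp_all add: ev_mult k scale_ev twisted.ev_mult h_def)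
  have h_lin: "Vector_Spaces.linear t t h"
    unfolding Vector_Spaces.linear_iff
  proof (intro conjI allI W.vector_space_axioms)
    show "h (v + w) = h v + h w" for v w
      by (subst h_eq[of "k v + k w"]) (simp_all add: ev_add k W.scale_right_distrib twisted.ev_add h_def)
    show "h (t c v) = t c (h v)" for c v
      using h_ev[of "free_scalar c" v] by (simp add: ev_scalar twisted.ev_scalar)
  qed
  interpret h: Vector_Spaces.linear t t h by (rule h_lin)
  have "inj h"
    unfolding h.inj_iff_eq_0
  proof (intro allI impI, rule ccontr)
    \<comment> \<open>Density moves a nonzero kernel vector \<open>w\<close> to \<open>v0\<close>,
      against the choice of \<open>w0\<close>.\<close>
    fix w assume w: "h w = 0" "w \<noteq> 0"
    interpret P: vector_space_pair t t by (intro vector_space_pair.intro W.vector_space_axioms)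
    have "W.independent {w}" using w by simp
    from P.linear_independent_extend[OF this, of "\<lambda>_. v0"]
    obtain T where "Vector_Spaces.linear t t T" "T w = v0" by auto
    then obtain x where "ev x w = v0" using ev_surj[OF S] by metis
    then have "h v0 = 0" using h_ev[of x w] w by (simp add: twisted.zero_ev)
    then show False using w0 by (simp add: h_def)
  qed
  moreover have "h (act x w) = act' x (h w)" for x w
    using h_ev[of "free_gen x" w] by (simp add: ev_gen twisted.ev_gen)
  \<comment> \<open>One algebra element acts as \<open>p\<close> on both modules, so commuting with
    \<open>p\<close> is a case of \<open>h_ev\<close>.\<close>
  moreover obtain c where "\<And>w. ev c w = p w" "\<And>w. twisted.ev c w = p w" using proj_central[OF S] by metis
  then have "h (p w) = p (h w)" for w using h_ev[of c w] by simp
  ultimately show ?thesis using that h_lin by blast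
qed

end

section \<open>The Clifford module of a composition\<close>

lemma (in quadratic_space) polar_simps:
  "polar q (x + y) z = polar q x z + polar q y z" "polar q z (x + y) = polar q z x + polar q z y"
  "polar q (scale c x) z = c * polar q x z" "polar q z (scale c x) = c * polar q z x"
  using polar_bilinear by (simp_all add: bilinear_map_def Vector_Spaces.linear_iff)

lemma polar_commute: "polar q x y = polar q y x"
  by (simp add: polar_def add.commute)

lemma (in nonsingular_quadratic_space) polar_eqI: "(\<And>x. polar q x y = polar q x z) \<Longrightarrow> y = z"
  using functional_ex1[of "\<lambda>x. polar q x z"] polar_bilinear unfolding bilinear_map_def by blast

lemma (in nonsingular_quadratic_space) ex_anisotropic:
  assumes "dim UNIV \<noteq> 0"
  shows "\<exists>x. q x \<noteq> 0"
proof (rule ccontr)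
  assume "\<not> ?thesis"
  then have "q x = 0" for x by simp
  then have "x = 0" for x :: 'b by (intro nonsingular) (simp add: polar_def)
  then have "(UNIV :: 'b set) = {0}" by auto
  then show False using assms dim_eq_card[OF _ independent_empty, of UNIV] by simp
qed

lemma (in quadratic_space) ex_basis:
  obtains B where "independent B" "span B = UNIV" "card B = dim UNIV" "finite_dimensional_vector_space scale B"
proof -
  obtain B0 where B0: "finite B0" "span B0 = UNIV" using finite_dim by blast
  obtain B where B: "B \<subseteq> UNIV" "independent B" "UNIV \<subseteq> span B" "card B = dim UNIV"
    using basis_exists[of UNIV] by blast
  have "finite B" using independent_span_bound[OF B0(1) B(2)] B0 by simp
  then have "finite_dimensional_vector_space scale B"
    by unfold_locales (use B in auto)
  then show ?thesis using that B by blast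
qed

lemma quadratic_space_inj_imp_surj:
  assumes "quadratic_space s q" "quadratic_space s' q'" "Vector_Spaces.linear s s' f" "inj f"
    and "vector_space.dim s UNIV = vector_space.dim s' UNIV"
  shows "surj f"
proof -
  interpret A: quadratic_space s q by fact
  interpret B: quadratic_space s' q' by fact
  obtain A where A: "finite_dimensional_vector_space s A" using A.ex_basis by blast
  obtain B where B: "finite_dimensional_vector_space s' B" using B.ex_basis by blast
  interpret finite_dimensional_vector_space_pair s A s' B
    using A B by (simp add: finite_dimensional_vector_space_pair_def
        finite_dimensional_vector_space_pair_1_def B.vector_space_axioms)
  show ?thesis using assms by (intro linear_injective_imp_surjective) simp_all
qed

context quadratic_composition
begin

section \<open>The adjoint of a composition\<close>

lemma star3_simps:
  "star3 (x + x') y = star3 x y + star3 x' y" "star3 x (y + y') = star3 x y + star3 x y'"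
  "star3 (s1 c x) y = s3 c (star3 x y)" "star3 x (s2 c y) = s3 c (star3 x y)"
  using star3_bilinear by (simp_all add: bilinear_map_def Vector_Spaces.linear_iff)

lemmas star3_diff = additive_minus[of "star3 x" for x, OF star3_simps(2)]

lemma polar_star3_right: "polar q3 (star3 x y) (star3 x y') = q1 x * polar q2 y y'"
  by (simp add: polar_def star3_mult right_diff_distrib flip: star3_simps)

lemma polar_star3_left: "polar q3 (star3 x y) (star3 x' y) = polar q1 x x' * q2 y"
  by (simp add: polar_def star3_mult left_diff_distrib flip: star3_simps)

text \<open>Up to the order of arguments, the derived composition of \<open>V3\<close> and
  \<open>V1\<close> into \<open>V2\<close>.\<close>

definition adj :: "'v1 \<Rightarrow> 'v3 \<Rightarrow> 'v2" where
  "adj x z = (THE u. \<forall>y. polar q2 y u = polar q3 z (star3 x y))"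

lemma polar_adj: "polar q2 y (adj x z) = polar q3 z (star3 x y)"
proof -
  have "Vector_Spaces.linear s2 (*) (\<lambda>y. polar q3 z (star3 x y))"
    unfolding Vector_Spaces.linear_iff
    using Q3.polar_bilinear
    by (simp add: star3_simps Q3.polar_simps Q2.vector_space_axioms bilinear_map_def Vector_Spaces.linear_iff)
  from theI'[OF Q2.functional_ex1[OF this]] show ?thesis unfolding adj_def by blast
qed

lemma adj_simps:
  "adj (x + x') z = adj x z + adj x' z" "adj x (z + z') = adj x z + adj x z'"
  "adj (s1 c x) z = s2 c (adj x z)" "adj x (s3 c z) = s2 c (adj x z)"
  by (rule Q2.polar_eqI; simp add: polar_adj Q2.polar_simps Q3.polar_simps star3_simps)+

text \<open>Polarised multiplicativity says that \<open>star3 x\<close> scales polar forms by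
  \<open>q1 x\<close>, also for isotropic \<open>x\<close>.\<close>

lemma adj_star3: "adj x (star3 x y) = s2 (q1 x) y"
  by (rule Q2.polar_eqI, simp add: polar_adj Q2.polar_simps polar_star3_right, metis polar_commute)

lemma adj_star3_swap: "adj x (star3 e y) = s2 (polar q1 x e) y - adj e (star3 x y)"
proof -
  have "adj (x + e) (star3 (x + e) y) = s2 (q1 (x + e)) y" by (rule adj_star3)
  then show ?thesis
    by (simp add: adj_simps star3_simps adj_star3 polar_def Q2.scale_left_diff_distrib algebra_simps)
qed

text \<open>By \<open>adj_star3\<close> a nonzero \<open>q1 e\<close> makes \<open>star3 e\<close>
  injective, and the dimensions agree.\<close>

lemma star3_surj_right:
  assumes "q1 e \<noteq> 0"
  shows "\<exists>y. z = star3 e y"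
proof -
  have "surj (star3 e)"
  proof (rule quadratic_space_inj_imp_surj)
    show "Vector_Spaces.linear s2 s3 (star3 e)" using star3_bilinear by (simp add: bilinear_map_def)
    show "inj (star3 e)"
      by (rule injI) (metis adj_star3 assms Q2.scale_cancel_left)
    show "vector_space.dim s2 (UNIV :: 'v2 set) = vector_space.dim s3 (UNIV :: 'v3 set)"
      using dim_12 dim_13 by simp
  qed (rule Q2.quadratic_space_axioms Q3.quadratic_space_axioms)+
  then show ?thesis by (auto simp: surj_def)
qed

lemma star3_surj_left:
  assumes "q2 y \<noteq> 0"
  shows "\<exists>x. z = star3 x y"
proof -
  have "surj (\<lambda>x. star3 x y)"
  proof (rule quadratic_space_inj_imp_surj)
    show "Vector_Spaces.linear s1 s3 (\<lambda>x. star3 x y)" using star3_bilinear by (simp add: bilinear_map_def)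
    show "inj (\<lambda>x. star3 x y)"
    proof (rule injI)
      fix x x' assume eq: "star3 x y = star3 x' y"
      show "x = x'"
      proof (rule Q1.polar_eqI)
        fix u
        have "polar q1 u x * q2 y = polar q1 u x' * q2 y"
          by (simp add: eq flip: polar_star3_left)
        then show "polar q1 u x = polar q1 u x'" using assms by simp
      qed
    qed
  qed (rule Q1.quadratic_space_axioms Q3.quadratic_space_axioms dim_13)+
  then show ?thesis by (auto simp: surj_def)
qed

text \<open>For isotropic \<open>x\<close> the operator \<open>star3 x\<close> is not invertible, so the identity is transported
  from an anisotropic vector \<open>e\<close> through the linearised relation.\<close>

lemma star3_adj:
  assumes "q1 e \<noteq> 0"
  shows "star3 x (adj x z) = s3 (q1 x) z"
proof -
  have e: "star3 e (adj e u) = s3 (q1 e) u" for u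
  proof -
    obtain y where "u = star3 e y" using star3_surj_right[OF assms] by blast
    then show ?thesis by (simp add: adj_star3 star3_simps)
  qed
  have xe: "star3 x (adj e u) + star3 e (adj x u) = s3 (polar q1 x e) u" for u
  proof -
    obtain y where y: "u = star3 e y" using star3_surj_right[OF assms] by blast
    have "star3 e (adj x u) = star3 e (s2 (polar q1 x e) y - adj e (star3 x y))"
      by (simp only: y adj_star3_swap[of x e y])
    also have "\<dots> = s3 (polar q1 x e) u - s3 (q1 e) (star3 x y)"
      by (simp add: star3_diff star3_simps e y)
    also have "s3 (q1 e) (star3 x y) = star3 x (adj e u)" by (simp add: y adj_star3 star3_simps)
    finally show ?thesis by simp
  qed
  obtain y where y: "z = star3 e y" using star3_surj_right[OF assms] by blast
  have "star3 x (adj x z) = star3 x (s2 (polar q1 x e) y - adj e (star3 x y))"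
    by (simp only: y adj_star3_swap[of x e y])
  also have "\<dots> = s3 (polar q1 x e) (star3 x y) - star3 x (adj e (star3 x y))"
    by (simp add: star3_diff star3_simps)
  also have "\<dots> = star3 e (adj x (star3 x y))"
    using xe[of "star3 x y"] by (simp add: algebra_simps)
  also have "\<dots> = s3 (q1 x) z" by (simp add: adj_star3 star3_simps y)
  finally show ?thesis .
qed

section \<open>The graded module on \<open>V2 \<times> V3\<close>\<close>

definition pair_scale where "pair_scale c = (\<lambda>(y, z). (s2 c y, s3 c z))"
definition pair_act where "pair_act x = (\<lambda>(y, z). (adj x z, star3 x y))"
definition pair_proj :: "'v2 \<times> 'v3 \<Rightarrow> 'v2 \<times> 'v3" where "pair_proj = (\<lambda>(y, z). (y, 0))"

lemmas pair_defs = pair_scale_def pair_act_def pair_proj_def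

lemma adj_0: "adj x 0 = 0" using adj_simps(2)[of x 0 0] by simp
lemma star3_0: "star3 x 0 = 0" using star3_simps(2)[of x 0 0] by simp

text \<open>The square is \<open>q1 x\<close> by \<open>adj_star3\<close> on \<open>V2\<close> and
  \<open>star3_adj\<close> on \<open>V3\<close>; nonzero dimension supplies the anisotropic vector
  for the latter.\<close>

lemma pair_clifford_module:
  assumes "Q1.dim UNIV \<noteq> 0"
  shows "clifford_module s1 q1 pair_scale pair_act pair_proj"
proof -
  obtain e where e: "q1 e \<noteq> 0" using Q1.ex_anisotropic assms by blast
  obtain y where y: "q2 y \<noteq> 0" using Q2.ex_anisotropic assms dim_12 by auto
  interpret W: vector_space pair_scale
    by standard (auto simp: pair_defs Q2.scale_right_distrib Q2.scale_left_distrib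
      Q3.scale_right_distrib Q3.scale_left_distrib)
  have "q2 0 = 0" using Q2.quad_scale[of 0 0] by simp
  then have "(y, 0 :: 'v3) \<noteq> 0" using y by (auto simp: zero_prod_def)
  then show ?thesis
    by unfold_locales
      (auto simp: pair_defs adj_simps star3_simps adj_star3 star3_adj[OF e] adj_0 star3_0)
qed

text \<open>In dimension 8 this gives at most 16 spanning vectors, and
  \<open>16\<^sup>2 = 2\<^sup>8\<close> meets the bound required for density.\<close>

lemma pair_spanning:
  "\<exists>S. finite S \<and> module.span pair_scale S = UNIV \<and> card S \<le> 2 * Q1.dim UNIV"
proof -
  interpret W: vector_space pair_scale
    by standard (auto simp: pair_defs Q2.scale_right_distrib Q2.scale_left_distrib
      Q3.scale_right_distrib Q3.scale_left_distrib)
  obtain A where A: "Q2.span A = UNIV" "card A = Q2.dim UNIV" "finite_dimensional_vector_space s2 A"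
    using Q2.ex_basis by metis
  obtain B where B: "Q3.span B = UNIV" "card B = Q3.dim UNIV" "finite_dimensional_vector_space s3 B"
    using Q3.ex_basis by metis
  have fin: "finite A" "finite B"
    using A(3) B(3) by (auto simp: finite_dimensional_vector_space_def finite_dimensional_vector_space_axioms_def)
  let ?S = "(\<lambda>y. (y, 0)) ` A \<union> (\<lambda>z. (0, z)) ` B"
  have y: "(y, 0) \<in> W.span ?S" if "y \<in> Q2.span A" for y
    using that
  proof (induction y rule: Q2.span_induct_alt)
    case base
    show ?case using W.span_zero[of ?S] by (simp add: zero_prod_def)
  next
    case (step c a y)
    have *: "(s2 c a + y, 0) = pair_scale c (a, 0) + (y, 0)" by (simp add: pair_defs)
    have "(a, 0) \<in> W.span ?S" using step by (intro W.span_base) simp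
    with step show ?case unfolding * by (intro W.span_add W.span_scale)
  qed
  have z: "(0, z) \<in> W.span ?S" if "z \<in> Q3.span B" for z
    using that
  proof (induction z rule: Q3.span_induct_alt)
    case base
    show ?case using W.span_zero[of ?S] by (simp add: zero_prod_def)
  next
    case (step c b z)
    have *: "(0, s3 c b + z) = pair_scale c (0, b) + (0, z)" by (simp add: pair_defs)
    have "(0, b) \<in> W.span ?S" using step by (intro W.span_base) simp
    with step show ?case unfolding * by (intro W.span_add W.span_scale)
  qed
  have "w \<in> W.span ?S" for w
    using W.span_add[OF y[of "fst w"] z[of "snd w"]] A(1) B(1) by simp
  moreover have "card ?S \<le> 2 * Q1.dim UNIV"
    using card_Un_le[of "(\<lambda>y. (y, 0 :: 'v3)) ` A" "(\<lambda>z. (0 :: 'v2, z)) ` B"]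
      card_image_le[OF fin(1), of "\<lambda>y. (y, 0 :: 'v3)"] card_image_le[OF fin(2), of "\<lambda>z. (0 :: 'v2, z)"]
      A(2) B(2) dim_12 dim_13 by linarith
  ultimately show ?thesis using fin by (intro exI[of _ ?S]) auto
qed

section \<open>Similitudes from the intertwiner\<close>

lemma similitudes_of_intertwiner:
  assumes h2: "Vector_Spaces.linear s2 s2 h2" "inj h2" and h3: "Vector_Spaces.linear s3 s3 h3" "inj h3"
    and g: "\<And>x. q1 (g x) = \<mu> * q1 x" "\<mu> \<noteq> 0"
    and h: "\<And>x y. h3 (star3 x y) = star3 (g x) (h2 y)"
    and dim: "Q1.dim UNIV \<noteq> 0"
  obtains \<nu> where "\<nu> \<noteq> 0" "\<And>z. q3 (h3 z) = \<nu> * q3 z" "\<And>y. q2 (h2 y) = \<nu> / \<mu> * q2 y"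
proof -
  obtain e where e: "q1 e \<noteq> 0" using Q1.ex_anisotropic dim by blast
  obtain y0 where y0: "q2 y0 \<noteq> 0" using Q2.ex_anisotropic dim dim_12 by auto
  obtain z0 where z0: "q3 z0 \<noteq> 0" using Q3.ex_anisotropic dim dim_13 by auto
  \<comment> \<open>Forced by \<open>z = star3 x y0\<close>, where
    \<open>q3 (h3 z) = \<mu> * q1 x * q2 (h2 y0)\<close> and
    \<open>q3 z = q1 x * q2 y0\<close>.\<close>
  define \<nu> where "\<nu> = \<mu> * q2 (h2 y0) / q2 y0"
  have q3: "q3 (h3 z) = \<nu> * q3 z" for z
  proof -
    obtain x where "z = star3 x y0" using star3_surj_left[OF y0] by blast
    then show ?thesis using y0 by (simp add: h star3_mult g \<nu>_def)
  qed
  have q2: "q2 (h2 y) = \<nu> / \<mu> * q2 y" for y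
  proof -
    have "(\<mu> * q1 e) * q2 (h2 y) = \<nu> * (q1 e * q2 y)"
      using q3[of "star3 e y"] by (simp add: h star3_mult g)
    then show ?thesis using e g(2) by (simp add: field_simps)
  qed
  have "surj h3" by (rule quadratic_space_inj_imp_surj[OF Q3.quadratic_space_axioms Q3.quadratic_space_axioms h3]) simp
  then obtain z where "z0 = h3 z" by (auto simp: surj_def)
  then have "\<nu> \<noteq> 0" using z0 q3[of z] by auto
  then show ?thesis using that q2 q3 by blast
qed

lemma proper_similitude_lift:
  assumes dim: "Q1.dim UNIV = 8" and g: "g \<in> GO_plus s1 q1"
  obtains h2 h3 where "Vector_Spaces.linear s2 s2 h2" "inj h2" "Vector_Spaces.linear s3 s3 h3" "inj h3"
    "\<And>x y. h3 (star3 x y) = star3 (g x) (h2 y)"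
proof -
  have "clifford_module s1 q1 pair_scale pair_act pair_proj"
    by (rule pair_clifford_module) (simp add: dim)
  then interpret C: clifford_module s1 q1 pair_scale pair_act pair_proj .
  interpret C: clifford_module_similitude s1 q1 pair_scale pair_act pair_proj g
    by unfold_locales (rule g)
  obtain S where S: "finite S" "C.W.span S = UNIV" "card S \<le> 16"
    using pair_spanning dim by auto
  have "(card S)\<^sup>2 \<le> 16\<^sup>2" using S(3) by (rule power_mono) simp
  then have "(card S)\<^sup>2 \<le> 2 ^ Q1.dim UNIV" by (simp add: dim)
  then obtain h where h: "Vector_Spaces.linear pair_scale pair_scale h" "inj h"
    "\<And>x w. h (pair_act x w) = C.act' x (h w)" "\<And>w. h (pair_proj w) = pair_proj (h w)"
    using C.intertwiner[OF S(1,2)] by metis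
  interpret h: Vector_Spaces.linear pair_scale pair_scale h by (rule h(1))
  \<comment> \<open>Commuting with \<open>pair_proj\<close> makes \<open>h\<close> preserve both
    summands.\<close>
  define h2 where "h2 y = fst (h (y, 0))" for y
  define h3 where "h3 z = snd (h (0, z))" for z
  have h2: "h (y, 0) = (h2 y, 0)" for y
    using h(4)[of "(y, 0)"] by (auto simp: h2_def pair_proj_def split: prod.splits)
  have h3: "h (0, z) = (0, h3 z)" for z
    using h(4)[of "(0, z)"] h.zero by (auto simp: h3_def pair_proj_def zero_prod_def split: prod.splits)
  have "Vector_Spaces.linear s2 s2 h2"
    unfolding Vector_Spaces.linear_iff
    using h.add[of "(_, 0)" "(_, 0)"] h.scale[of _ "(_, 0)"]
    by (auto simp: h2 pair_scale_def Q2.vector_space_axioms)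
  moreover have "Vector_Spaces.linear s3 s3 h3"
    unfolding Vector_Spaces.linear_iff
    using h.add[of "(0, _)" "(0, _)"] h.scale[of _ "(0, _)"]
    by (auto simp: h3 pair_scale_def Q3.vector_space_axioms)
  moreover have "inj h2" by (rule injI) (metis h2 h(2) injD prod.inject)
  moreover have "inj h3" by (rule injI) (metis h3 h(2) injD prod.inject)
  \<comment> \<open>On the first summand the twisted action carries no factor
    \<open>inverse m\<close>.\<close>
  moreover have "h3 (star3 x y) = star3 (g x) (h2 y)" for x y
    using h(3)[of x "(y, 0)"] unfolding C.act'_def
    by (simp add: pair_act_def adj_0 h2 h3 zero_prod_def pair_proj_def pair_scale_def star3_0)
  ultimately show ?thesis using that by blast
qed

end

section \<open>Transfer to the derived composition\<close>

theorem corollary3p24: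
  fixes s1 :: "'f::field \<Rightarrow> 'v1::ab_group_add \<Rightarrow> 'v1" and q1 :: "'v1 \<Rightarrow> 'f"
    and s2 :: "'f \<Rightarrow> 'v2::ab_group_add \<Rightarrow> 'v2" and q2 :: "'v2 \<Rightarrow> 'f"
    and s3 :: "'f \<Rightarrow> 'v3::ab_group_add \<Rightarrow> 'v3" and q3 :: "'v3 \<Rightarrow> 'f"
    and star3 :: "'v1 \<Rightarrow> 'v2 \<Rightarrow> 'v3" and g1 :: "'v1 \<Rightarrow> 'v1"
  assumes "quadratic_composition s1 q1 s2 q2 s3 q3 star3"
    and "vector_space.dim s1 (UNIV :: 'v1 set) = 8"
    and "g1 \<in> GO_plus s1 q1"
  shows "\<exists>g2\<in>GO s2 q2. \<exists>g3\<in>GO s3 q3. \<forall>x2 x3.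
    g1 (derived_star1 q1 q3 star3 x2 x3) = derived_star1 q1 q3 star3 (g2 x2) (g3 x3)"
proof -
  interpret quadratic_composition s1 q1 s2 q2 s3 q3 star3 by fact
  let ?d = "derived_star1 q1 q3 star3"
  have g1: "g1 \<in> GO s1 q1" using assms(3) by (simp add: GO_plus_def)
  define \<mu> where "\<mu> = multiplier q1 g1"
  have \<mu>: "\<mu> \<noteq> 0" "q1 (g1 x) = \<mu> * q1 x" for x using multiplier[OF g1] by (simp_all add: \<mu>_def)
  obtain h2 h3 where h2: "Vector_Spaces.linear s2 s2 h2" "inj h2"
    and h3: "Vector_Spaces.linear s3 s3 h3" "inj h3"
    and h: "\<And>x y. h3 (star3 x y) = star3 (g1 x) (h2 y)"
    using proper_similitude_lift[OF assms(2,3)] by metis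
  obtain \<nu> where \<nu>: "\<nu> \<noteq> 0" "\<And>z. q3 (h3 z) = \<nu> * q3 z" "\<And>y. q2 (h2 y) = \<nu> / \<mu> * q2 y"
    using similitudes_of_intertwiner[OF h2 h3 \<mu>(2,1) h] assms(2) by auto
  \<comment> \<open>In the defining identity of the derived map \<open>g1\<close> scales the polar
    form by \<open>\<mu>\<close> and \<open>h3\<close> by \<open>\<nu>\<close>; the factor balances
    the two.\<close>
  define g3 where "g3 z = s3 (\<mu> / \<nu>) (h3 z)" for z
  have h3_add: "h3 (x + y) = h3 x + h3 y" and h3_scale: "h3 (s3 c x) = s3 c (h3 x)" for x y c
    using h3(1) by (simp_all add: Vector_Spaces.linear_iff)
  have g3_lin: "Vector_Spaces.linear s3 s3 g3"
    unfolding Vector_Spaces.linear_iff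
    by (simp add: g3_def h3_add h3_scale Q3.scale_right_distrib Q3.vector_space_axioms mult.commute)
  have g3_inj: "inj g3"
    using h3(2) \<mu>(1) \<nu>(1) by (auto simp: inj_def g3_def)
  have "bij h2" "bij g3"
    using quadratic_space_inj_imp_surj[OF Q2.quadratic_space_axioms Q2.quadratic_space_axioms h2]
      quadratic_space_inj_imp_surj[OF Q3.quadratic_space_axioms Q3.quadratic_space_axioms g3_lin g3_inj]
      h2(2) g3_inj by (simp_all add: bij_def)
  moreover have "q3 (g3 z) = (\<mu>\<^sup>2 / \<nu>) * q3 z" for z
    using \<nu>(1) by (simp add: g3_def Q3.quad_scale \<nu>(2) power2_eq_square)
  moreover have "\<nu> / \<mu> \<noteq> 0" "\<mu>\<^sup>2 / \<nu> \<noteq> 0" using \<mu>(1) \<nu>(1) by simp_all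
  ultimately have GO: "h2 \<in> GO s2 q2" "g3 \<in> GO s3 q3"
    using h2(1) g3_lin \<nu>(3) unfolding GO_def by blast+
  have "g1 (?d x2 x3) = ?d (h2 x2) (g3 x3)" for x2 x3
  proof (rule Q1.polar_eqI)
    fix u
    \<comment> \<open>As \<open>g1\<close> is surjective, testing against its values
      suffices.\<close>
    obtain x1 where u: "u = g1 x1" using g1 by (auto simp: GO_def bij_def surj_def)
    have g1_add: "g1 (x + y) = g1 x + g1 y" for x y
      using g1 by (simp add: GO_def Vector_Spaces.linear_iff)
    have "polar q1 (g1 x1) (g1 (?d x2 x3)) = \<mu> * polar q1 x1 (?d x2 x3)"
      by (simp add: polar_def \<mu>(2) right_diff_distrib flip: g1_add)
    also have "\<dots> = (\<mu> / \<nu>) * (\<nu> * polar q3 x3 (star3 x1 x2))"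
      using \<nu>(1) by (simp add: derived_star1)
    also have "\<nu> * polar q3 x3 (star3 x1 x2) = polar q3 (h3 x3) (h3 (star3 x1 x2))"
      by (simp add: polar_def \<nu>(2) right_diff_distrib flip: h3_add)
    also have "(\<mu> / \<nu>) * polar q3 (h3 x3) (h3 (star3 x1 x2)) = polar q1 (g1 x1) (?d (h2 x2) (g3 x3))"
      by (simp add: derived_star1 h g3_def Q3.polar_simps)
    finally show "polar q1 u (g1 (?d x2 x3)) = polar q1 u (?d (h2 x2) (g3 x3))" by (simp add: u)
  qed
  then show ?thesis using GO by blast
qed

end
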